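(* The braided Hopf superalgebra $U_\hbar=U_\hbar(\mathfrak{gl}(1|1))$, with universal $R$-matrix $R=\Theta\Upsilon$, is a ribbon Hopf superalgebra with ribbon element $$v=K^{-1}u=uK^{-1}=(K^{-1}+(q-q^{-1})EF)\,e^{\hbar(H_2^2-H_1^2)}.$$ That is, $v$ is an even central element of $U_\hbar$ satisfying $$v^2=uS(u),\qquad \boldsymbol{\mathrm{u}}(v)=1,\qquad S(v)=v,\qquad \Delta(v)=(R_{21}R_{12})^{-1}(v\otimes v).$$
   Context: Superobjects are $\mathbb{Z}/2\mathbb{Z}$-graded; $|x|$ denotes the degree of a homogeneous element $x$. The (completed) tensor product of superalgebras has product $(a\otimes b)(c\otimes d)=(-1)^{|b||c|}ac\otimes bd$. $U_\hbar$ is the unital $\mathbb{C}[[\hbar]]$-superalgebra, complete for the $\hbar$-adic topology, topologically generated by $E,F,H_1,H_2$ with $|H_1|=|H_2|=0$, $|E|=|F|=1$, subject to: $H_1H_2=H_2H_1$; $H_iE-EH_i=\langle H_i,\alpha\rangle E$; $H_iF-FH_i=-\langle H_i,\alpha\rangle F$, where $\langle H_1,\alpha\rangle=1$, $\langle H_2,\alpha\rangle=-1$; $EF+FE=\frac{e^{\hbar(H_1+H_2)}-e^{-\hbar(H_1+H_2)}}{e^{\hbar}-e^{-\hbar}}$; $E^2=F^2=0$. (Both numerator and denominator are divisible by $\hbar$, and $(e^\hbar-e^{-\hbar})/\hbar$ is invertible in $\mathbb{C}[[\hbar]]$.) Put $q=e^\hbar$, $K=e^{\hbar(H_1+H_2)}$.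 $\hat\otimes$ is the $\hbar$-adically completed tensor product. Hopf superalgebra structure: $\Delta(E)=E\otimes K^{-1}+1\otimes E$, $\Delta(F)=F\otimes1+K\otimes F$, $\Delta(H_i)=H_i\otimes1+1\otimes H_i$; $S(E)=-EK$, $S(F)=-K^{-1}F$, $S(H_i)=-H_i$; counit $\boldsymbol{\mathrm{u}}(E)=\boldsymbol{\mathrm{u}}(F)=\boldsymbol{\mathrm{u}}(H_i)=0$; $\Delta,\boldsymbol{\mathrm{u}}$ are superalgebra homomorphisms, and $S$ is an anti-homomorphism of superalgebras, $S(xy)=(-1)^{|x||y|}S(y)S(x)$. $R=\Theta\Upsilon\in U_\hbar\hat\otimes U_\hbar$ with $\Upsilon=e^{\hbar(H_1\otimes H_1-H_2\otimes H_2)}$ and $\Theta=1+(q-q^{-1})F\otimes E$. $R_{12}=R$ and $R_{21}=\sigma(R)$, where $\sigma(a\otimes b)=(-1)^{|a||b|}b\otimes a$. A Hopf superalgebra is braided with universal $R$-matrix $R$ if $R$ is invertible, $R\Delta(x)=\sigma(\Delta(x))R$ for all $x$, $(\Delta\otimes\mathrm{id})(R)=R_{13}R_{23}$ and $(\mathrm{id}\otimes\Delta)(R)=R_{13}R_{12}$; $U_\hbar$ is braided in this sense. Writing $R=\sum_r a_r\otimes b_r$, put $u=\sum_r(-1)^{|a_r||b_r|}S(b_r)a_r$; explicitly $u=(1+(q-q^{-1})EKF)e^{\hbar(H_2^2-H_1^2)}$, which is an invertible central element. *)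

theory Defs
  imports
    "HOL-Computational_Algebra.Formal_Power_Series"
    "HOL-Library.Poly_Mapping"
begin

section \<open>Complex superalgebras with a monomial basis\<close>

text \<open>
  A monoid of basis monomials with a degree \<open>bpar\<close> (only its parity matters) and a sign
  \<open>bsgn\<close>: in the associated superalgebra the product of the basis vectors \<open>a\<close> and \<open>b\<close> is
  \<open>bsgn a b\<close> times the basis vector \<open>bmul a b\<close>. For words the sign is trivial; for pairs it is the
  sign rule of the tensor product of superalgebras.
\<close>

class superbasis =
  fixes bone :: 'a
    and bmul :: "'a \<Rightarrow> 'a \<Rightarrow> 'a"
    and bpar :: "'a \<Rightarrow> nat"
    and bsgn :: "'a \<Rightarrow> 'a \<Rightarrow> complex"
  assumes bmul_assoc: "bmul (bmul a b) c = bmul a (bmul b c)"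
    and bmul_bone [simp]: "bmul a bone = a"
    and bone_bmul [simp]: "bmul bone a = a"
    and bpar_bone [simp]: "bpar bone = 0"
    and bpar_bmul [simp]: "bpar (bmul a b) = bpar a + bpar b"
    and bsgn_bone [simp]: "bsgn a bone = 1"
    and bone_bsgn [simp]: "bsgn bone a = 1"
    and bsgn_cocycle: "bsgn a b * bsgn (bmul a b) c = bsgn b c * bsgn a (bmul b c)"

typedef 'a salg = "UNIV :: ('a \<Rightarrow>\<^sub>0 complex) set"
  morphisms vec of_vec ..

setup_lifting type_definition_salg

instantiation salg :: (type) ab_group_add
begin
lift_definition zero_salg :: "'a salg" is 0 .
lift_definition plus_salg :: "'a salg \<Rightarrow> 'a salg \<Rightarrow> 'a salg" is "(+)" .
lift_definition minus_salg :: "'a salg \<Rightarrow> 'a salg \<Rightarrow> 'a salg" is "(-)" .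
lift_definition uminus_salg :: "'a salg \<Rightarrow> 'a salg" is uminus .
instance by standard (transfer; simp add: algebra_simps)+
end

definition smul :: "('a::superbasis \<Rightarrow>\<^sub>0 complex) \<Rightarrow> ('a \<Rightarrow>\<^sub>0 complex) \<Rightarrow> ('a \<Rightarrow>\<^sub>0 complex)" where
  "smul f g = (\<Sum>a\<in>Poly_Mapping.keys f. \<Sum>b\<in>Poly_Mapping.keys g.
     Poly_Mapping.single (bmul a b) (bsgn a b * Poly_Mapping.lookup f a * Poly_Mapping.lookup g b))"

lemma smul_superset:
  assumes "finite A" "finite B" "Poly_Mapping.keys f \<subseteq> A" "Poly_Mapping.keys g \<subseteq> B"
  shows "smul f g = (\<Sum>a\<in>A. \<Sum>b\<in>B.
     Poly_Mapping.single (bmul a b) (bsgn a b * Poly_Mapping.lookup f a * Poly_Mapping.lookup g b))"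
proof -
  have "smul f g = (\<Sum>a\<in>Poly_Mapping.keys f. \<Sum>b\<in>B.
     Poly_Mapping.single (bmul a b) (bsgn a b * Poly_Mapping.lookup f a * Poly_Mapping.lookup g b))"
    unfolding smul_def
    by (intro sum.cong refl sum.mono_neutral_left) (use assms in \<open>auto simp: in_keys_iff\<close>)
  also have "\<dots> = (\<Sum>a\<in>A. \<Sum>b\<in>B.
     Poly_Mapping.single (bmul a b) (bsgn a b * Poly_Mapping.lookup f a * Poly_Mapping.lookup g b))"
    by (intro sum.mono_neutral_left) (use assms in \<open>auto simp: in_keys_iff\<close>)
  finally show ?thesis .
qed

lemma smul_add_left: "smul (f + f') g = smul f g + smul f' g"
proof -
  let ?A = "Poly_Mapping.keys f \<union> Poly_Mapping.keys f' \<union> Poly_Mapping.keys (f + f')"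
  have *: "finite ?A" "finite (Poly_Mapping.keys g)" by auto
  show ?thesis
    by (subst smul_superset[OF *], blast, blast,
        subst smul_superset[OF *], blast, blast,
        subst smul_superset[OF *], blast, blast)
      (simp add: sum.distrib [symmetric] lookup_add single_add [symmetric] algebra_simps)
qed

lemma smul_add_right: "smul g (f + f') = smul g f + smul g f'"
proof -
  let ?A = "Poly_Mapping.keys f \<union> Poly_Mapping.keys f' \<union> Poly_Mapping.keys (f + f')"
  have *: "finite (Poly_Mapping.keys g)" "finite ?A" by auto
  show ?thesis
    by (subst smul_superset[OF *], blast, blast,
        subst smul_superset[OF *], blast, blast,
        subst smul_superset[OF *], blast, blast)
      (simp add: sum.distrib [symmetric] lookup_add single_add [symmetric] algebra_simps)
qed

lemma smul_zero [simp]: "smul 0 g = 0" "smul g 0 = 0"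
  by (simp_all add: smul_def)

lemma smul_sum_left: "smul (sum h I) g = (\<Sum>i\<in>I. smul (h i) g)"
  by (induction I rule: infinite_finite_induct) (simp_all add: smul_add_left)

lemma smul_sum_right: "smul g (sum h I) = (\<Sum>i\<in>I. smul g (h i))"
  by (induction I rule: infinite_finite_induct) (simp_all add: smul_add_right)

lemma smul_single:
  "smul (Poly_Mapping.single a c) (Poly_Mapping.single b d) =
     Poly_Mapping.single (bmul a b) (bsgn a b * c * d)"
  by (subst smul_superset[of "{a}" "{b}"]) auto

lemma sum_single_keys: "(\<Sum>a\<in>Poly_Mapping.keys f. Poly_Mapping.single a (Poly_Mapping.lookup f a)) = f"
  by (rule poly_mapping_eqI)
    (simp add: lookup_sum lookup_single when_def sum.delta in_keys_iff)

lemma smul_assoc_single: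
  "smul (smul (Poly_Mapping.single a x) (Poly_Mapping.single b y)) (Poly_Mapping.single c z) =
   smul (Poly_Mapping.single a x) (smul (Poly_Mapping.single b y) (Poly_Mapping.single c z))"
proof -
  have "bsgn (bmul a b) c * (bsgn a b * x * y) * z = bsgn a b * bsgn (bmul a b) c * (x * y * z)"
    by (simp add: mult_ac)
  also have "\<dots> = bsgn a (bmul b c) * x * (bsgn b c * y * z)"
    unfolding bsgn_cocycle by (simp add: mult_ac)
  finally show ?thesis
    by (simp only: smul_single bmul_assoc)
qed

lemma smul_assoc: "smul (smul f g) h = smul f (smul g h)"
proof -
  let ?s = "\<lambda>f. \<Sum>a\<in>Poly_Mapping.keys f. Poly_Mapping.single a (Poly_Mapping.lookup f a)"
  have "smul (smul (?s f) (?s g)) (?s h) = smul (?s f) (smul (?s g) (?s h))"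
    by (simp only: smul_sum_left smul_sum_right smul_assoc_single)
  thus ?thesis by (simp only: sum_single_keys)
qed

lemma smul_one_left: "smul (Poly_Mapping.single bone 1) f = f"
  by (subst smul_superset[of "{bone}" "Poly_Mapping.keys f"]) (auto simp: sum_single_keys)

lemma smul_one_right: "smul f (Poly_Mapping.single bone 1) = f"
  by (subst smul_superset[of "Poly_Mapping.keys f" "{bone}"]) (auto simp: sum_single_keys)

instantiation salg :: (superbasis) ring_1
begin
lift_definition one_salg :: "'a salg" is "Poly_Mapping.single bone 1" .
lift_definition times_salg :: "'a salg \<Rightarrow> 'a salg \<Rightarrow> 'a salg" is smul .
instance
proof
  show "(0::'a salg) \<noteq> 1"
    by transfer (metis lookup_single_eq lookup_zero zero_neq_one)
qed (transfer; simp add: smul_assoc smul_add_left smul_add_right smul_one_left smul_one_right)+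
end

definition basis_vec :: "'a \<Rightarrow> 'a salg" where
  "basis_vec a = of_vec (Poly_Mapping.single a 1)"

definition scalar :: "complex \<Rightarrow> 'a::superbasis salg" where
  "scalar c = of_vec (Poly_Mapping.single bone c)"

definition scalar_fps :: "complex fps \<Rightarrow> 'a::superbasis salg fps" where
  "scalar_fps c = Abs_fps (\<lambda>n. scalar (fps_nth c n))"

definition map_basis :: "('a \<Rightarrow> 'b) \<Rightarrow> 'a salg \<Rightarrow> 'b salg" where
  "map_basis h f = of_vec (\<Sum>a\<in>Poly_Mapping.keys (vec f). Poly_Mapping.single (h a) (Poly_Mapping.lookup (vec f) a))"

definition map_basis_fps :: "('a \<Rightarrow> 'b) \<Rightarrow> 'a salg fps \<Rightarrow> 'b salg fps" where
  "map_basis_fps h f = Abs_fps (\<lambda>n. map_basis h (fps_nth f n))"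

section \<open>Topologically presented \<open>\<complex>[[\<hbar>]]\<close>-superalgebras\<close>

text \<open>
  For a superalgebra \<open>A\<close> over the complex numbers, \<open>A[[\<hbar>]]\<close> is the \<open>\<hbar>\<close>-adic completion of
  \<open>A \<otimes> \<complex>[[\<hbar>]]\<close>, and the metric on formal power series induces the \<open>\<hbar>\<close>-adic topology.
  The algebra topologically presented by a set of relations is its quotient by the smallest closed
  two-sided ideal containing the relations.
\<close>

class presented = superbasis +
  fixes relators :: "'a salg fps set"

definition two_sided_ideal :: "'r::ring_1 set \<Rightarrow> bool" where
  "two_sided_ideal I \<longleftrightarrow> 0 \<in> I \<and> (\<forall>x\<in>I. \<forall>y\<in>I. x + y \<in> I) \<and>
     (\<forall>x\<in>I. \<forall>r. r * x \<in> I \<and> x * r \<in> I)"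

definition rel_ideal :: "'a::presented salg fps set" where
  "rel_ideal = \<Inter>{I. two_sided_ideal I \<and> closed I \<and> relators \<subseteq> I}"

lemma two_sided_ideal_rel_ideal: "two_sided_ideal rel_ideal"
  unfolding rel_ideal_def two_sided_ideal_def by blast

lemma rel_ideal_zero: "0 \<in> rel_ideal"
  and rel_ideal_add: "x \<in> rel_ideal \<Longrightarrow> y \<in> rel_ideal \<Longrightarrow> x + y \<in> rel_ideal"
  and rel_ideal_left: "x \<in> rel_ideal \<Longrightarrow> r * x \<in> rel_ideal"
  and rel_ideal_right: "x \<in> rel_ideal \<Longrightarrow> x * r \<in> rel_ideal"
  using two_sided_ideal_rel_ideal unfolding two_sided_ideal_def by blast+

lemma rel_ideal_uminus: "x \<in> rel_ideal \<Longrightarrow> - x \<in> rel_ideal"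
  using rel_ideal_left[of x "- 1"] by simp

lemma rel_ideal_diff: "x \<in> rel_ideal \<Longrightarrow> y \<in> rel_ideal \<Longrightarrow> x - y \<in> rel_ideal"
  using rel_ideal_add[of x "- y"] rel_ideal_uminus[of y] by simp

lemma relators_rel_ideal: "r \<in> relators \<Longrightarrow> r \<in> rel_ideal"
  unfolding rel_ideal_def by blast

lemma closed_rel_ideal: "closed rel_ideal"
  unfolding rel_ideal_def by (rule closed_Inter) blast

quotient_type (overloaded) 'a halg = "'a::presented salg fps" / "\<lambda>x y. x - y \<in> rel_ideal"
proof (rule equivpI)
  show "reflp (\<lambda>x y::'a salg fps. x - y \<in> rel_ideal)"
    by (simp add: reflp_def rel_ideal_zero)
  show "symp (\<lambda>x y::'a salg fps. x - y \<in> rel_ideal)"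
    using rel_ideal_uminus by (fastforce simp: symp_def)
  show "transp (\<lambda>x y::'a salg fps. x - y \<in> rel_ideal)"
    using rel_ideal_add by (fastforce simp: transp_def)
qed

instantiation halg :: (presented) "{ring, monoid_mult}"
begin
lift_definition zero_halg :: "'a halg" is 0 .
lift_definition one_halg :: "'a halg" is 1 .
lift_definition plus_halg :: "'a halg \<Rightarrow> 'a halg \<Rightarrow> 'a halg" is "(+)"
  by (simp only: add_diff_add rel_ideal_add)
lift_definition uminus_halg :: "'a halg \<Rightarrow> 'a halg" is uminus
  by (simp only: minus_diff_minus rel_ideal_uminus)
lift_definition minus_halg :: "'a halg \<Rightarrow> 'a halg \<Rightarrow> 'a halg" is "(-)"
proof -
  fix a b c d :: "'a salg fps"
  assume "a - b \<in> rel_ideal" "c - d \<in> rel_ideal"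
  hence "(a - b) - (c - d) \<in> rel_ideal" by (rule rel_ideal_diff)
  thus "a - c - (b - d) \<in> rel_ideal" by (simp add: algebra_simps)
qed
lift_definition times_halg :: "'a halg \<Rightarrow> 'a halg \<Rightarrow> 'a halg" is "(*)"
proof -
  fix a b c d :: "'a salg fps"
  assume "a - b \<in> rel_ideal" "c - d \<in> rel_ideal"
  hence "(a - b) * c + b * (c - d) \<in> rel_ideal"
    by (intro rel_ideal_add rel_ideal_left rel_ideal_right)
  thus "a * c - b * d \<in> rel_ideal" by (simp add: algebra_simps)
qed
instance by standard (transfer; simp add: algebra_simps rel_ideal_zero)+
end

definition hbasis :: "'a::presented \<Rightarrow> 'a halg" where
  "hbasis a = abs_halg (fps_const (basis_vec a))"

definition hscalar :: "complex fps \<Rightarrow> 'a::presented halg" where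
  "hscalar c = abs_halg (scalar_fps c)"

text \<open>The sum of the convergent series \<open>\<Sum>n. \<hbar>\<^sup>n x\<^sub>n\<close>.\<close>

definition hseries :: "(nat \<Rightarrow> 'a::presented halg) \<Rightarrow> 'a halg" where
  "hseries x = abs_halg (Abs_fps (\<lambda>m. \<Sum>n\<le>m. fps_nth (rep_halg (x n)) (m - n)))"

text \<open>The exponential \<open>e\<^bsup>\<hbar>x\<^esup>\<close>.\<close>

definition hexp :: "'a::presented halg \<Rightarrow> 'a halg" where
  "hexp x = hseries (\<lambda>n. hscalar (fps_const (1 / fact n)) * x ^ n)"

text \<open>
  The continuous \<open>\<complex>[[\<hbar>]]\<close>-linear map with prescribed values \<open>\<phi>\<close> on the basis monomials. It is
  evaluated on a representative of the class \<open>x\<close>, and is only meaningful if the continuous linear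
  extension of \<open>\<phi>\<close> to power series annihilates \<^const>\<open>rel_ideal\<close>, as it does in all uses below.
\<close>

definition lin_ext :: "('a::presented \<Rightarrow> 'b::presented halg) \<Rightarrow> 'a halg \<Rightarrow> 'b halg" where
  "lin_ext \<phi> x = hseries (\<lambda>n. let f = vec (fps_nth (rep_halg x) n) in
     \<Sum>a\<in>Poly_Mapping.keys f. hscalar (fps_const (Poly_Mapping.lookup f a)) * \<phi> a)"

definition even_elem :: "'a::presented halg \<Rightarrow> bool" where
  "even_elem x \<longleftrightarrow>
     (\<exists>f. x = abs_halg f \<and> (\<forall>n. \<forall>a\<in>Poly_Mapping.keys (vec (fps_nth f n)). even (bpar a)))"

section \<open>The completed tensor product\<close>

text \<open>
  The \<open>\<hbar>\<close>-adically completed tensor product of \<open>A[[\<hbar>]]\<close> and \<open>B[[\<hbar>]]\<close> is \<open>(A \<otimes> B)[[\<hbar>]]\<close>, and the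
  completed tensor product is right exact; hence the completed tensor product of the quotients
  \<open>A[[\<hbar>]] / I\<close> and \<open>B[[\<hbar>]] / J\<close> is the quotient of \<open>(A \<otimes> B)[[\<hbar>]]\<close> by the closed ideal generated by
  \<open>I \<otimes> 1\<close> and \<open>1 \<otimes> J\<close> (for homogeneous relations).
\<close>

instantiation prod :: (superbasis, superbasis) superbasis
begin
definition bone_prod :: "'a \<times> 'b" where
  "bone_prod = (bone, bone)"
definition bmul_prod :: "'a \<times> 'b \<Rightarrow> 'a \<times> 'b \<Rightarrow> 'a \<times> 'b" where
  "bmul_prod x y = (bmul (fst x) (fst y), bmul (snd x) (snd y))"
definition bpar_prod :: "'a \<times> 'b \<Rightarrow> nat" where
  "bpar_prod x = bpar (fst x) + bpar (snd x)"
definition bsgn_prod :: "'a \<times> 'b \<Rightarrow> 'a \<times> 'b \<Rightarrow> complex" where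
  "bsgn_prod x y = (-1) ^ (bpar (snd x) * bpar (fst y)) *
     bsgn (fst x) (fst y) * bsgn (snd x) (snd y)"
instance
proof
  fix a b c :: "'a \<times> 'b"
  let ?s = "(-1) ^ (bpar (snd a) * bpar (fst b) + bpar (snd a) * bpar (fst c) +
    bpar (snd b) * bpar (fst c)) :: complex"
  have "bsgn a b * bsgn (bmul a b) c = ?s *
      (bsgn (fst a) (fst b) * bsgn (bmul (fst a) (fst b)) (fst c)) *
      (bsgn (snd a) (snd b) * bsgn (bmul (snd a) (snd b)) (snd c))"
    by (simp add: bsgn_prod_def bmul_prod_def power_add algebra_simps)
  also have "\<dots> = bsgn b c * bsgn a (bmul b c)"
    unfolding bsgn_cocycle by (simp add: bsgn_prod_def bmul_prod_def power_add algebra_simps)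
  finally show "bsgn a b * bsgn (bmul a b) c = bsgn b c * bsgn a (bmul b c)" .
qed (auto simp: bone_prod_def bmul_prod_def bpar_prod_def bsgn_prod_def bmul_assoc)
end

instantiation prod :: (presented, presented) presented
begin
definition relators_prod :: "('a \<times> 'b) salg fps set" where
  "relators_prod = map_basis_fps (\<lambda>a. (a, bone)) ` relators \<union>
     map_basis_fps (\<lambda>b. (bone, b)) ` relators"
instance ..
end

definition tensor :: "'a::presented halg \<Rightarrow> 'b::presented halg \<Rightarrow> ('a \<times> 'b) halg"
    (infixl \<open>\<otimes>\<^sub>h\<close> 72) where
  "x \<otimes>\<^sub>h y = abs_halg (map_basis_fps (\<lambda>a. (a, bone)) (rep_halg x) *
     map_basis_fps (\<lambda>b. (bone, b)) (rep_halg y))"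

text \<open>The flip \<open>a \<otimes> b \<mapsto> (-1)\<^bsup>|a||b|\<^esup> b \<otimes> a\<close>.\<close>

definition flip :: "('a::presented \<times> 'b::presented) halg \<Rightarrow> ('b \<times> 'a) halg" where
  "flip = lin_ext (\<lambda>(a, b). (- 1) ^ (bpar a * bpar b) * hbasis (b, a))"

section \<open>The algebra \<open>U\<^sub>\<hbar>(gl(1|1))\<close>\<close>

datatype gen = gE | gF | gH1 | gH2

datatype word = Word (letters: "gen list")

fun gen_par :: "gen \<Rightarrow> nat" where
  "gen_par gE = 1"
| "gen_par gF = 1"
| "gen_par gH1 = 0"
| "gen_par gH2 = 0"

instantiation word :: superbasis
begin
definition bone_word :: word where
  "bone_word = Word []"
definition bmul_word :: "word \<Rightarrow> word \<Rightarrow> word" where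
  "bmul_word v w = Word (letters v @ letters w)"
definition bpar_word :: "word \<Rightarrow> nat" where
  "bpar_word w = sum_list (map gen_par (letters w))"
definition bsgn_word :: "word \<Rightarrow> word \<Rightarrow> complex" where
  "bsgn_word v w = 1"
instance
  by standard (auto simp: bone_word_def bmul_word_def bpar_word_def bsgn_word_def)
end

text \<open>
  The relations live in the completed free algebra. Both \<open>(e\<^bsup>\<hbar>h\<^esup> - e\<^bsup>-\<hbar>h\<^esup>) / \<hbar>\<close> and
  \<open>(e\<^bsup>\<hbar>\<^esup> - e\<^bsup>-\<hbar>\<^esup>) / \<hbar>\<close> are obtained with \<^const>\<open>fps_shift\<close>.
\<close>

definition free_gen :: "gen \<Rightarrow> word salg fps" where
  "free_gen g = fps_const (basis_vec (Word [g]))"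

definition free_exp :: "word salg \<Rightarrow> word salg fps" where
  "free_exp x = Abs_fps (\<lambda>n. scalar (1 / fact n) * x ^ n)"

definition gl11_relators :: "word salg fps set" where
  "gl11_relators =
     (let E = free_gen gE; F = free_gen gF; H1 = free_gen gH1; H2 = free_gen gH2;
          h = basis_vec (Word [gH1]) + basis_vec (Word [gH2])
      in {H1 * H2 - H2 * H1,
          H1 * E - E * H1 - E,
          H2 * E - E * H2 + E,
          H1 * F - F * H1 + F,
          H2 * F - F * H2 - F,
          E * F + F * E -
            scalar_fps (inverse (fps_shift 1 (fps_exp 1 - fps_exp (- 1)))) *
              fps_shift 1 (free_exp h - free_exp (- h)),
          E * E,
          F * F})"

instantiation word :: presented
begin
definition relators_word :: "word salg fps set" where
  "relators_word = gl11_relators"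
instance ..
end

type_synonym Uh = "word halg"
type_synonym UhUh = "(word \<times> word) halg"

definition E\<^sub>h :: Uh where "E\<^sub>h = hbasis (Word [gE])"
definition F\<^sub>h :: Uh where "F\<^sub>h = hbasis (Word [gF])"
definition H1\<^sub>h :: Uh where "H1\<^sub>h = hbasis (Word [gH1])"
definition H2\<^sub>h :: Uh where "H2\<^sub>h = hbasis (Word [gH2])"

definition K\<^sub>h :: Uh where "K\<^sub>h = hexp (H1\<^sub>h + H2\<^sub>h)"
definition Kinv\<^sub>h :: Uh where "Kinv\<^sub>h = hexp (- (H1\<^sub>h + H2\<^sub>h))"

text \<open>\<open>q - q\<^sup>-\<^sup>1\<close> with \<open>q = e\<^sup>\<hbar>\<close>.\<close>

definition q_diff :: "complex fps" where
  "q_diff = fps_exp 1 - fps_exp (- 1)"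

section \<open>Hopf structure, R-matrix and the element \<open>u\<close>\<close>

fun comult_gen :: "gen \<Rightarrow> UhUh" where
  "comult_gen gE = E\<^sub>h \<otimes>\<^sub>h Kinv\<^sub>h + 1 \<otimes>\<^sub>h E\<^sub>h"
| "comult_gen gF = F\<^sub>h \<otimes>\<^sub>h 1 + K\<^sub>h \<otimes>\<^sub>h F\<^sub>h"
| "comult_gen gH1 = H1\<^sub>h \<otimes>\<^sub>h 1 + 1 \<otimes>\<^sub>h H1\<^sub>h"
| "comult_gen gH2 = H2\<^sub>h \<otimes>\<^sub>h 1 + 1 \<otimes>\<^sub>h H2\<^sub>h"

definition comult :: "Uh \<Rightarrow> UhUh" where
  "comult = lin_ext (\<lambda>w. prod_list (map comult_gen (letters w)))"

fun antipode_gen :: "gen \<Rightarrow> Uh" where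
  "antipode_gen gE = - (E\<^sub>h * K\<^sub>h)"
| "antipode_gen gF = - (Kinv\<^sub>h * F\<^sub>h)"
| "antipode_gen gH1 = - H1\<^sub>h"
| "antipode_gen gH2 = - H2\<^sub>h"

fun antipode_word :: "gen list \<Rightarrow> Uh" where
  "antipode_word [] = 1"
| "antipode_word (g # w) =
     (- 1) ^ (gen_par g * bpar (Word w)) * (antipode_word w * antipode_gen g)"

definition antipode :: "Uh \<Rightarrow> Uh" where
  "antipode = lin_ext (\<lambda>w. antipode_word (letters w))"

text \<open>The counit is multiplicative and kills the generators, hence every nonempty word.\<close>

definition counit :: "Uh \<Rightarrow> complex fps" where
  "counit x = Abs_fps (\<lambda>n. Poly_Mapping.lookup (vec (fps_nth (rep_halg x) n)) (Word []))"

definition Upsilon :: UhUh where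
  "Upsilon = hexp (H1\<^sub>h \<otimes>\<^sub>h H1\<^sub>h - H2\<^sub>h \<otimes>\<^sub>h H2\<^sub>h)"

definition Theta :: UhUh where
  "Theta = 1 + hscalar q_diff * (F\<^sub>h \<otimes>\<^sub>h E\<^sub>h)"

definition R\<^sub>h :: UhUh where
  "R\<^sub>h = Theta * Upsilon"

definition R21\<^sub>h :: UhUh where
  "R21\<^sub>h = flip R\<^sub>h"

text \<open>The image of \<open>R\<close> under \<open>a \<otimes> b \<mapsto> (-1)\<^bsup>|a||b|\<^esup> S(b) a\<close>.\<close>

definition u\<^sub>h :: Uh where
  "u\<^sub>h = lin_ext (\<lambda>(a, b). (- 1) ^ (bpar a * bpar b) * (antipode (hbasis b) * hbasis a)) R\<^sub>h"

end

theory Submission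
  imports Defs
begin

text \<open>
  Put \<open>z = q - q\<^sup>-\<^sup>1\<close> and \<open>T = e\<^bsup>\<hbar>(H\<^sub>2\<^sup>2 - H\<^sub>1\<^sup>2)\<^esup>\<close>. Evaluating the definition of \<open>u\<close> on \<open>\<Theta>\<Upsilon>\<close> gives
  \<open>u = (1 + z EKF) T\<close>, hence \<open>v = (K\<^sup>-\<^sup>1 + z EF) T\<close>. Everything else is a computation with the
  relations \<open>z (EF + FE) = K - K\<^sup>-\<^sup>1\<close>, \<open>T E = E K\<^sup>-\<^sup>2 T\<close>, \<open>T F = F K\<^sup>2 T\<close> and the centrality of \<open>K\<close>. For the
  coproduct, \<open>\<Upsilon> (F \<otimes> E) = (FK \<otimes> EK\<^sup>-\<^sup>1) \<Upsilon>\<close> gives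
  \<open>R\<^sub>2\<^sub>1 R\<^sub>1\<^sub>2 = (1 - z E \<otimes> F) (1 + z FK \<otimes> EK\<^sup>-\<^sup>1) \<Upsilon>\<^sup>2\<close>, while \<open>\<Delta>(T) = (T \<otimes> T) \<Upsilon>\<^sup>-\<^sup>2\<close>; multiplying out shows
  \<open>R\<^sub>2\<^sub>1 R\<^sub>1\<^sub>2 \<Delta>(v) = v \<otimes> v\<close>.

  The structure maps are evaluated on representatives of classes in a topologically presented algebra.
  They are well defined because a continuous linear map vanishes on the closed ideal of relations as
  soon as it kills \<open>a r c\<close> for all relators \<open>r\<close> and all monomials \<open>a\<close>, \<open>c\<close>.
\<close>

section \<open>Scalars and the \<open>\<hbar>\<close>-adic topology\<close>

text \<open>No basis of the quotient is constructed: every identity is derived from the relations,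
  so torsion is not excluded and neither \<open>hbar\<close> nor \<open>q_diff\<close> may be
  cancelled. This shapes the formulas. The relation for EF + FE is carried in its divided form,
  through \<open>hsinh2\<close>, whose addition formula has to be proved on coefficients; and in the
  calculations with v a factor \<open>q_diff\<close> stays in front wherever FE is replaced. What
  the closed ideal does provide is separatedness: an element divisible by every power of
  \<open>hbar\<close> vanishes. Hence \<complex>[[\<hbar>]]-linear maps are automatically
  continuous, and identities of series follow by splitting off leading terms. The antipode and the
  map a \<otimes> b \<mapsto> \<plusminus> S(b) a are not homomorphisms; for them the outer
  monomials a, c stay in play, and the signs they create come out only because the relators are
  homogeneous. Tensor calculations are done in one algebra generated by two supercommuting images of
  the factors.\<close>

lemma scalar_0 [simp]: "scalar 0 = 0"
  by (simp add: scalar_def zero_salg_def)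

lemma scalar_1 [simp]: "scalar 1 = 1"
  by (simp add: scalar_def one_salg_def)

lemma scalar_add: "scalar (c + d) = scalar c + scalar d"
  by (simp add: scalar_def plus_salg.abs_eq eq_onp_def single_add)

lemma scalar_mult: "scalar (c * d) = scalar c * scalar d"
  by (simp add: scalar_def times_salg.abs_eq eq_onp_def smul_single)

lemma scalar_sum: "scalar (sum f A) = (\<Sum>i\<in>A. scalar (f i))"
  by (induction A rule: infinite_finite_induct) (simp_all add: scalar_add)

lemma vec_scalar_left: "vec (scalar c * x) =
    (\<Sum>b\<in>Poly_Mapping.keys (vec x). Poly_Mapping.single b (c * Poly_Mapping.lookup (vec x) b))"
  unfolding scalar_def times_salg.rep_eq of_vec_inverse[OF UNIV_I]
  by (subst smul_superset[of "{bone}" "Poly_Mapping.keys (vec x)"]) auto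

lemma vec_scalar_right: "vec (x * scalar c) =
    (\<Sum>b\<in>Poly_Mapping.keys (vec x). Poly_Mapping.single b (c * Poly_Mapping.lookup (vec x) b))"
  unfolding scalar_def times_salg.rep_eq of_vec_inverse[OF UNIV_I]
  by (subst smul_superset[of "Poly_Mapping.keys (vec x)" "{bone}"]) (auto simp: mult.commute)

lemma scalar_commute: "scalar c * x = x * scalar c"
  by (metis vec_scalar_left vec_scalar_right vec_inject)

lemma lookup_scalar_mult:
  "Poly_Mapping.lookup (vec (scalar c * s)) a = c * Poly_Mapping.lookup (vec s) a"
  by (auto simp: vec_scalar_left lookup_sum lookup_single when_def sum.delta in_keys_iff)

lemma basis_vec_bone [simp]: "basis_vec bone = 1"
  by (simp add: basis_vec_def one_salg_def)

lemma basis_vec_mult: "basis_vec a * basis_vec b = scalar (bsgn a b) * basis_vec (bmul a b)"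
  by (simp add: basis_vec_def scalar_def times_salg.abs_eq eq_onp_def smul_single)

lemma of_vec_sum: "of_vec (sum f A) = (\<Sum>i\<in>A. of_vec (f i))"
  by (induction A rule: infinite_finite_induct)
    (simp_all add: zero_salg_def plus_salg.abs_eq [symmetric] eq_onp_def)

lemma salg_expand:
  "s = (\<Sum>a\<in>Poly_Mapping.keys (vec s). scalar (Poly_Mapping.lookup (vec s) a) * basis_vec a)"
proof -
  have "s = of_vec (\<Sum>a\<in>Poly_Mapping.keys (vec s).
      Poly_Mapping.single a (Poly_Mapping.lookup (vec s) a))"
    by (simp add: sum_single_keys vec_inverse)
  also have "\<dots> = (\<Sum>a\<in>Poly_Mapping.keys (vec s). scalar (Poly_Mapping.lookup (vec s) a) * basis_vec a)"
    unfolding of_vec_sum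
    by (simp add: basis_vec_def scalar_def times_salg.abs_eq eq_onp_def smul_single)
  finally show ?thesis .
qed

lemma salg_induct [case_names zero basis add]:
  assumes "P 0" "\<And>c a. P (scalar c * basis_vec a)" "\<And>s t. P s \<Longrightarrow> P t \<Longrightarrow> P (s + t)"
  shows "P s"
proof -
  have "P (\<Sum>a\<in>A. scalar (f a) * basis_vec a)" for A and f :: "'a \<Rightarrow> complex"
    by (induction A rule: infinite_finite_induct) (use assms in auto)
  thus ?thesis using salg_expand[of s] by metis
qed

lemma scalar_fps_nth [simp]: "fps_nth (scalar_fps c) n = scalar (fps_nth c n)"
  by (simp add: scalar_fps_def)

lemma scalar_fps_add: "scalar_fps (c + d) = scalar_fps c + scalar_fps d"
  by (simp add: fps_eq_iff scalar_add)

lemma scalar_fps_mult: "scalar_fps (c * d) = scalar_fps c * scalar_fps d"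
  by (simp add: fps_eq_iff fps_mult_nth scalar_sum scalar_mult)

lemma scalar_fps_const: "scalar_fps (fps_const c) = fps_const (scalar c)"
  by (simp add: fps_eq_iff)

lemma scalar_fps_1 [simp]: "scalar_fps 1 = 1"
  by (simp add: fps_eq_iff)

lemma scalar_fps_X [simp]: "scalar_fps fps_X = fps_X"
  by (simp add: fps_eq_iff fps_X_def)

lemma scalar_fps_commute: "scalar_fps c * f = f * scalar_fps c"
proof (rule fps_ext)
  fix n
  have "fps_nth (scalar_fps c * f) n = (\<Sum>i=0..n. fps_nth f (n - i) * scalar (fps_nth c i))"
    by (simp add: fps_mult_nth scalar_commute)
  also have "\<dots> = fps_nth (f * scalar_fps c) n"
    by (simp add: fps_mult_nth) (rule sum.reindex_bij_witness[of _ "\<lambda>i. n - i" "\<lambda>i. n - i"]; simp)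
  finally show "fps_nth (scalar_fps c * f) n = fps_nth (f * scalar_fps c) n" .
qed

lemma hscalar_add: "hscalar (c + d) = hscalar c + hscalar d"
  by (simp add: hscalar_def scalar_fps_add plus_halg.abs_eq)

lemma hscalar_mult: "hscalar (c * d) = hscalar c * hscalar d"
  by (simp add: hscalar_def scalar_fps_mult times_halg.abs_eq)

lemma hscalar_1 [simp]: "hscalar 1 = 1"
  by (simp add: hscalar_def one_halg.abs_eq)

lemma hscalar_0 [simp]: "hscalar 0 = 0"
  using hscalar_add[of 0 0] by (metis add_0 add_left_cancel add_0_right)

lemma hscalar_uminus: "hscalar (- c) = - hscalar c"
  using hscalar_add[of c "- c"] by (simp add: eq_neg_iff_add_eq_0 add.commute)

lemma hscalar_commute: "hscalar c * x = x * hscalar c"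
  by (induction x rule: halg.abs_induct) (simp add: hscalar_def times_halg.abs_eq scalar_fps_commute)

lemma hscalar_left_commute: "x * (hscalar c * y) = hscalar c * (x * y)"
  by (metis hscalar_commute mult.assoc)

lemma neg_one_power: "(- 1) ^ n = (hscalar (fps_const ((- 1) ^ n)) :: 'a::presented halg)"
proof (induction n)
  case (Suc n)
  have "hscalar (fps_const ((- 1) ^ Suc n)) = (hscalar (- 1 * fps_const ((- 1) ^ n)) :: 'a halg)"
    by simp
  also have "\<dots> = - hscalar (fps_const ((- 1) ^ n))"
    by (simp only: hscalar_mult hscalar_uminus hscalar_1) simp
  finally show ?case by (simp add: Suc.IH)
qed simp

text \<open>The series sharing the first k coefficients of f form a neighbourhood basis of f, so
  approximability modulo every \<open>fps_X ^ k\<close> is membership in the closure.\<close>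

lemma closed_fps_approx:
  assumes "closed (S :: 'a::ring_1 fps set)" "\<And>k. \<exists>g. f - fps_X ^ k * g \<in> S"
  shows "f \<in> S"
proof (rule ccontr)
  assume "f \<notin> S"
  with assms(1) obtain n where n: "{G. fps_cutoff n G = fps_cutoff n f} \<subseteq> - S"
    unfolding closed_def open_fps_iff by auto
  obtain g where g: "f - fps_X ^ n * g \<in> S" using assms(2) by blast
  have "fps_cutoff n (f - fps_X ^ n * g) = fps_cutoff n f"
    by (simp add: fps_eq_iff fps_X_power_mult_nth)
  with n g show False by blast
qed

text \<open>The criterion by which annihilators will be recognised as closed: a series that agrees
  with f below degree k differs from f by \<open>fps_X ^ k\<close> times the shifted
  difference.\<close>

lemma closed_fpsI:
  assumes "\<And>f. (\<And>k. \<exists>g. f - fps_X ^ k * g \<in> S) \<Longrightarrow> f \<in> S"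
  shows "closed (S :: 'a::ring_1 fps set)"
  unfolding closed_def open_fps_iff
proof safe
  fix f assume "f \<notin> S"
  then obtain k where k: "\<And>g. f - fps_X ^ k * g \<notin> S" using assms by blast
  have "G \<notin> S" if "fps_cutoff k G = fps_cutoff k f" for G
  proof -
    have "fps_nth G n = fps_nth f n" if "n < k" for n
      using \<open>fps_cutoff k G = fps_cutoff k f\<close> that by (metis fps_cutoff_nth)
    hence "G = f - fps_X ^ k * fps_shift k (f - G)"
      by (auto simp: fps_eq_iff fps_X_power_mult_nth)
    thus ?thesis using k by metis
  qed
  thus "\<exists>n. {G. fps_cutoff n G = fps_cutoff n f} \<subseteq> - S" by blast
qed

section \<open>Separatedness and convergent series\<close>

abbreviation hbar :: "'a::presented halg" where "hbar \<equiv> hscalar fps_X"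

lemma hbar_power_mult: "hbar ^ k * abs_halg f = abs_halg (fps_X ^ k * f)"
  by (induction k) (simp_all add: hscalar_def times_halg.abs_eq mult.assoc)

lemma abs_halg_eq_0_iff: "abs_halg f = 0 \<longleftrightarrow> f \<in> rel_ideal"
  by (simp add: zero_halg_def halg.abs_eq_iff)

text \<open>This is where closedness of \<open>rel_ideal\<close> enters: a representative of x lies
  in the ideal modulo every power of \<open>fps_X\<close>, hence in the ideal.\<close>

lemma hbar_divisible_eq_0:
  assumes "\<And>k. \<exists>y. x = hbar ^ k * y"
  shows "x = 0"
proof -
  obtain f where f: "x = abs_halg f" by (metis Quotient_abs_rep[OF Quotient_halg])
  have "\<exists>g. f - fps_X ^ k * g \<in> rel_ideal" for k
  proof -
    obtain y where y: "x = hbar ^ k * y" using assms by blast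
    obtain g where "y = abs_halg g" by (metis Quotient_abs_rep[OF Quotient_halg])
    with y f have "abs_halg f = abs_halg (fps_X ^ k * g)" by (simp add: hbar_power_mult)
    thus ?thesis by (metis halg.abs_eq_iff)
  qed
  hence "f \<in> rel_ideal" by (rule closed_fps_approx[OF closed_rel_ideal])
  thus ?thesis by (simp add: f abs_halg_eq_0_iff)
qed

text \<open>
  Identities between convergent series are proved by splitting off one term at a time: if every
  value of \<open>A\<close> is \<open>\<hbar>\<close> times another value, then \<open>A\<close> vanishes because the topology is separated.
\<close>

lemma hbar_peel:
  fixes A :: "'c \<Rightarrow> 'a::presented halg"
  assumes "\<And>x. \<exists>y. A x = hbar * A y"
  shows "A x = 0"
proof (rule hbar_divisible_eq_0)
  fix k
  have "\<exists>y. A x = hbar ^ k * A y" for x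
  proof (induction k arbitrary: x)
    case (Suc k)
    thus ?case using assms by (metis power_Suc2 mult.assoc)
  qed (auto intro: exI[of _ x])
  thus "\<exists>y. A x = hbar ^ k * y" by blast
qed

text \<open>\<open>hseries\<close> is defined through chosen representatives; this recursion
  mentions none and, by separatedness, determines the sum.\<close>

lemma hseries_Suc: "hseries x = x 0 + hbar * hseries (\<lambda>n. x (Suc n))"
proof -
  define r where "r n = rep_halg (x n)" for n
  have "Abs_fps (\<lambda>m. \<Sum>n\<le>m. fps_nth (r n) (m - n)) =
      r 0 + fps_X * Abs_fps (\<lambda>m. \<Sum>n\<le>m. fps_nth (r (Suc n)) (m - n))"
  proof (rule fps_ext)
    fix m
    show "fps_nth (Abs_fps (\<lambda>m. \<Sum>n\<le>m. fps_nth (r n) (m - n))) m =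
      fps_nth (r 0 + fps_X * Abs_fps (\<lambda>m. \<Sum>n\<le>m. fps_nth (r (Suc n)) (m - n))) m"
      by (cases m) (simp_all add: sum.atMost_Suc_shift del: sum.atMost_Suc)
  qed
  hence "hseries x = abs_halg (r 0) + hbar * hseries (\<lambda>n. x (Suc n))"
    by (simp add: hseries_def r_def plus_halg.abs_eq times_halg.abs_eq hscalar_def)
  thus ?thesis by (simp add: r_def Quotient_abs_rep[OF Quotient_halg])
qed

lemma hseries_add: "hseries (\<lambda>n. x n + y n) = hseries x + hseries y"
proof -
  \<comment> \<open>\<open>hbar_peel\<close> moves a single index, so the two sequences are packed
    into a pair and shifted together.\<close>
  define A where "A p = hseries (\<lambda>n. fst p n + snd p n) - (hseries (fst p) + hseries (snd p))"
    for p :: "(nat \<Rightarrow> 'a halg) \<times> (nat \<Rightarrow> 'a halg)"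
  have "A p = hbar * A (\<lambda>n. fst p (Suc n), \<lambda>n. snd p (Suc n))" for p
    using hseries_Suc[of "\<lambda>n. fst p n + snd p n"] hseries_Suc[of "fst p"] hseries_Suc[of "snd p"]
    by (simp add: A_def algebra_simps)
  hence "A (x, y) = 0" by (intro hbar_peel[where A = A]) blast
  thus ?thesis by (simp add: A_def)
qed

definition hlin :: "('a::presented halg \<Rightarrow> 'b::presented halg) \<Rightarrow> bool" where
  "hlin L \<longleftrightarrow> (\<forall>x y. L (x + y) = L x + L y) \<and> (\<forall>c x. L (hscalar c * x) = hscalar c * L x)"

lemma hlin_add: "hlin L \<Longrightarrow> L (x + y) = L x + L y"
  and hlin_hscalar: "hlin L \<Longrightarrow> L (hscalar c * x) = hscalar c * L x"
  by (simp_all add: hlin_def)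

lemma hlin_0: "hlin L \<Longrightarrow> L 0 = 0"
  using hlin_add[of L 0 0] by simp

lemma hlin_uminus: "hlin L \<Longrightarrow> L (- x) = - L x"
  using hlin_add[of L x "- x"] by (simp add: hlin_0 eq_neg_iff_add_eq_0 add.commute)

lemma hlin_diff: "hlin L \<Longrightarrow> L (x - y) = L x - L y"
  using hlin_add[of L x "- y"] by (simp add: hlin_uminus)

text \<open>Linearity includes commuting with \<open>hbar\<close>, so shifting the sequence
  reproduces the difference of the two sides up to a factor \<open>hbar\<close>. Continuity is thus
  automatic in the \<hbar>-adic topology.\<close>

lemma hlin_hseries:
  assumes "hlin L"
  shows "L (hseries x) = hseries (\<lambda>n. L (x n))"
proof -
  define A where "A x = L (hseries x) - hseries (\<lambda>n. L (x n))" for x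
  have "A x = hbar * A (\<lambda>n. x (Suc n))" for x
    using hseries_Suc[of x] hseries_Suc[of "\<lambda>n. L (x n)"]
    by (simp add: A_def hlin_add[OF assms] hlin_hscalar[OF assms] algebra_simps)
  hence "A x = 0" by (intro hbar_peel[where A = A]) blast
  thus ?thesis by (simp add: A_def)
qed

lemma hlin_mult_left: "hlin (\<lambda>x. y * x)"
  by (simp add: hlin_def distrib_left hscalar_left_commute)

lemma hlin_mult_right: "hlin (\<lambda>x. x * y)"
  by (simp add: hlin_def distrib_right mult.assoc)

lemmas hseries_mult_left = hlin_hseries[OF hlin_mult_left]
lemmas hseries_mult_right = hlin_hseries[OF hlin_mult_right]

lemma hlin_comp: "hlin L \<Longrightarrow> hlin M \<Longrightarrow> hlin (\<lambda>x. L (M x))"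
  by (simp add: hlin_def)

lemma hseries_0 [simp]: "hseries (\<lambda>n. 0) = 0"
  using hseries_mult_left[of 0 "\<lambda>n. 0"] by simp

section \<open>Linear extension from the basis monomials\<close>

text \<open>The variant of \<open>hlin\<close> for maps that start from series over the free
  algebra, where no choice of representatives intervenes.\<close>

definition flin :: "('a::presented salg fps \<Rightarrow> 'b::presented halg) \<Rightarrow> bool" where
  "flin L \<longleftrightarrow> (\<forall>x y. L (x + y) = L x + L y) \<and> (\<forall>c x. L (scalar_fps c * x) = hscalar c * L x)"

lemma flin_add: "flin L \<Longrightarrow> L (x + y) = L x + L y"
  and flin_scalar: "flin L \<Longrightarrow> L (scalar_fps c * x) = hscalar c * L x"
  by (simp_all add: flin_def)

lemma flin_const_scalar: "flin L \<Longrightarrow> L (fps_const (scalar c) * x) = hscalar (fps_const c) * L x"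
  using flin_scalar[of L "fps_const c" x] by (simp add: scalar_fps_const)

lemma flin_X: "flin L \<Longrightarrow> L (fps_X * x) = hbar * L x"
  using flin_scalar[of L fps_X x] by simp

lemma flin_0: "flin L \<Longrightarrow> L 0 = 0"
  using flin_add[of L 0 0] by simp

lemma flin_uminus: "flin L \<Longrightarrow> L (- x) = - L x"
  using flin_add[of L x "- x"] by (simp add: flin_0 eq_neg_iff_add_eq_0 add.commute)

lemma flin_diff: "flin L \<Longrightarrow> L (x - y) = L x - L y"
  using flin_add[of L x "- y"] by (simp add: flin_uminus)

lemma fps_split_head: "f = fps_const (fps_nth f 0) + fps_X * fps_shift 1 f"
  for f :: "'a::ring_1 fps"
  by (auto simp: fps_eq_iff)

lemma flin_hseries:
  assumes "flin L"
  shows "L f = hseries (\<lambda>n. L (fps_const (fps_nth f n)))"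
proof -
  define A where "A f = L f - hseries (\<lambda>n. L (fps_const (fps_nth f n)))" for f
  have "A f = hbar * A (fps_shift 1 f)" for f
  proof -
    have "L f = L (fps_const (fps_nth f 0)) + hbar * L (fps_shift 1 f)"
      by (subst fps_split_head) (simp add: flin_add[OF assms] flin_X[OF assms])
    thus ?thesis
      using hseries_Suc[of "\<lambda>n. L (fps_const (fps_nth f n))"] by (simp add: A_def algebra_simps)
  qed
  hence "A f = 0" by (intro hbar_peel[where A = A]) blast
  thus ?thesis by (simp add: A_def)
qed

text \<open>The basis monomials span a dense submodule: \<open>salg_induct\<close> covers finite
  combinations, automatic continuity the infinite series.\<close>

lemma flin_eqI:
  assumes L: "flin L" and M: "flin M"
    and eq: "\<And>a. L (fps_const (basis_vec a)) = M (fps_const (basis_vec a))"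
  shows "L f = M f"
proof -
  have "L (fps_const s) = M (fps_const s)" for s
  proof (induction s rule: salg_induct)
    case (basis c a)
    show ?case
      using flin_const_scalar[OF L, of c "fps_const (basis_vec a)"]
        flin_const_scalar[OF M, of c "fps_const (basis_vec a)"] eq by simp
  next
    case (add s t)
    thus ?case by (simp add: fps_const_add [symmetric] flin_add[OF L] flin_add[OF M] del: fps_const_add)
  qed (simp add: flin_0[OF L] flin_0[OF M])
  thus ?thesis by (subst flin_hseries[OF L], subst flin_hseries[OF M]) simp
qed

text \<open>Constants and \<open>fps_X\<close> topologically generate \<complex>[[\<hbar>]]; peeling
  constant terms off the scalar passes from these to all power series.\<close>

lemma flinI:
  assumes add: "\<And>x y. L (x + y) = L x + L y"
    and const: "\<And>c x. L (fps_const (scalar c) * x) = hscalar (fps_const c) * L x"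
    and X: "\<And>x. L (fps_X * x) = hbar * L x"
  shows "flin L"
  unfolding flin_def
proof (intro conjI allI)
  fix c x
  define A where "A c = L (scalar_fps c * x) - hscalar c * L x" for c
  have "A c = hbar * A (fps_shift 1 c)" for c
  proof -
    have c: "c = fps_const (fps_nth c 0) + fps_X * fps_shift 1 c" by (rule fps_split_head)
    have "L (scalar_fps c * x) =
        hscalar (fps_const (fps_nth c 0)) * L x + hbar * L (scalar_fps (fps_shift 1 c) * x)"
      by (subst c) (simp only: scalar_fps_add scalar_fps_mult scalar_fps_const scalar_fps_X
          distrib_right add const mult.assoc X)
    moreover have "hscalar c * L x =
        hscalar (fps_const (fps_nth c 0)) * L x + hbar * (hscalar (fps_shift 1 c) * L x)"
      by (subst c) (simp only: hscalar_add hscalar_mult distrib_right mult.assoc)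
    ultimately show ?thesis by (simp add: A_def algebra_simps)
  qed
  hence "A c = 0" by (intro hbar_peel[where A = A]) blast
  thus "L (scalar_fps c * x) = hscalar c * L x" by (simp add: A_def)
qed (rule add)

definition salg_lin :: "('a::superbasis \<Rightarrow> 'b::presented halg) \<Rightarrow> 'a salg \<Rightarrow> 'b halg" where
  "salg_lin \<phi> s = (\<Sum>a\<in>Poly_Mapping.keys (vec s).
     hscalar (fps_const (Poly_Mapping.lookup (vec s) a)) * \<phi> a)"

lemma salg_lin_superset:
  assumes "finite A" "Poly_Mapping.keys (vec s) \<subseteq> A"
  shows "salg_lin \<phi> s = (\<Sum>a\<in>A. hscalar (fps_const (Poly_Mapping.lookup (vec s) a)) * \<phi> a)"
  unfolding salg_lin_def
  by (rule sum.mono_neutral_left) (use assms in \<open>auto simp: in_keys_iff\<close>)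

lemma salg_lin_add: "salg_lin \<phi> (s + t) = salg_lin \<phi> s + salg_lin \<phi> t"
proof -
  let ?A = "Poly_Mapping.keys (vec s) \<union> Poly_Mapping.keys (vec t) \<union> Poly_Mapping.keys (vec (s + t))"
  have *: "finite ?A" by simp
  show ?thesis
    by (subst (1 2 3) salg_lin_superset[OF *])
      (auto simp: plus_salg.rep_eq lookup_add fps_const_add [symmetric] hscalar_add
        distrib_right sum.distrib simp del: fps_const_add)
qed

lemma salg_lin_scalar: "salg_lin \<phi> (scalar c * s) = hscalar (fps_const c) * salg_lin \<phi> s"
proof -
  have *: "Poly_Mapping.keys (vec (scalar c * s)) \<subseteq> Poly_Mapping.keys (vec s)"
    by (auto simp: in_keys_iff lookup_scalar_mult)
  show ?thesis
    by (subst salg_lin_superset[OF _ *])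
      (auto simp: lookup_scalar_mult salg_lin_def sum_distrib_left mult.assoc [symmetric]
        hscalar_mult [symmetric])
qed

lemma salg_lin_basis [simp]: "salg_lin \<phi> (basis_vec a) = \<phi> a"
  by (subst salg_lin_superset[of "{a}"]) (auto simp: basis_vec_def of_vec_inverse)

lemma salg_lin_0 [simp]: "salg_lin \<phi> 0 = 0"
  using salg_lin_add[of \<phi> 0 0] by simp

text \<open>\<open>lin_ext\<close> before passing to the quotient. It acts on the series themselves
  and is therefore linear whether or not \<phi> respects the relations.\<close>

definition fps_ext_lin :: "('a::presented \<Rightarrow> 'b::presented halg) \<Rightarrow> 'a salg fps \<Rightarrow> 'b halg" where
  "fps_ext_lin \<phi> f = hseries (\<lambda>n. salg_lin \<phi> (fps_nth f n))"

lemma lin_ext_eq: "lin_ext \<phi> x = fps_ext_lin \<phi> (rep_halg x)"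
  by (simp add: lin_ext_def fps_ext_lin_def salg_lin_def Let_def)

lemma flin_fps_ext_lin: "flin (fps_ext_lin \<phi>)"
proof (rule flinI)
  show "fps_ext_lin \<phi> (x + y) = fps_ext_lin \<phi> x + fps_ext_lin \<phi> y" for x y
    by (simp add: fps_ext_lin_def salg_lin_add hseries_add)
  show "fps_ext_lin \<phi> (fps_const (scalar c) * x) = hscalar (fps_const c) * fps_ext_lin \<phi> x" for c x
    by (simp add: fps_ext_lin_def salg_lin_scalar hseries_mult_left)
  show "fps_ext_lin \<phi> (fps_X * x) = hbar * fps_ext_lin \<phi> x" for x
    using hseries_Suc[of "\<lambda>n. salg_lin \<phi> (fps_nth (fps_X * x) n)"] by (simp add: fps_ext_lin_def)
qed

lemma fps_ext_lin_basis [simp]: "fps_ext_lin \<phi> (fps_const (basis_vec a)) = \<phi> a"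
  using hseries_Suc[of "\<lambda>n. salg_lin \<phi> (fps_nth (fps_const (basis_vec a)) n)"]
  by (simp add: fps_ext_lin_def)

lemma flin_mult_left: "flin L \<Longrightarrow> flin (\<lambda>f. L (g * f))"
  unfolding flin_def by (metis distrib_left mult.assoc scalar_fps_commute)

lemma flin_mult_right: "flin L \<Longrightarrow> flin (\<lambda>f. L (f * g))"
  unfolding flin_def by (metis distrib_right mult.assoc)

lemma flin_hlin: "hlin M \<Longrightarrow> flin L \<Longrightarrow> flin (\<lambda>f. M (L f))"
  by (simp add: flin_def hlin_def)

lemma flin_abs_halg: "flin abs_halg"
  by (simp add: flin_def plus_halg.abs_eq times_halg.abs_eq hscalar_def)

lemma flin_zero: "flin (\<lambda>f. 0)"
  by (simp add: flin_def)

lemma hlin_eqI: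
  assumes "hlin L" "hlin M" "\<And>a. L (hbasis a) = M (hbasis a)"
  shows "L x = M x"
proof -
  have "L (abs_halg f) = M (abs_halg f)" for f
    by (rule flin_eqI[OF flin_hlin[OF assms(1) flin_abs_halg] flin_hlin[OF assms(2) flin_abs_halg]])
      (use assms(3) in \<open>simp add: hbasis_def\<close>)
  thus ?thesis by (metis Quotient_abs_rep[OF Quotient_halg])
qed

section \<open>Descent of linear maps to the quotient\<close>

definition kills_relators :: "('a::presented \<Rightarrow> 'b::presented halg) \<Rightarrow> bool" where
  "kills_relators \<phi> \<longleftrightarrow> (\<forall>a c. \<forall>r\<in>relators.
     fps_ext_lin \<phi> (fps_const (basis_vec a) * r * fps_const (basis_vec c)) = 0)"

text \<open>The set \<open>N\<close> is the largest two-sided ideal on which the map vanishes. It is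
  closed because the target is separated, and linearity in the two outer factors reduces the
  membership of a relator to its monomial multiples.\<close>

lemma fps_ext_lin_rel_ideal:
  assumes "kills_relators \<phi>" "f \<in> rel_ideal"
  shows "fps_ext_lin \<phi> f = 0"
proof -
  define N where "N = {f. \<forall>x y. fps_ext_lin \<phi> (x * f * y) = 0}"
  note lin = flin_fps_ext_lin[of \<phi>]
  have "two_sided_ideal N"
    unfolding two_sided_ideal_def N_def
  proof (intro conjI ballI allI CollectI; clarify?)
    fix f r x y assume *: "\<forall>x y. fps_ext_lin \<phi> (x * f * y) = 0"
    show "fps_ext_lin \<phi> (x * (r * f) * y) = 0" "fps_ext_lin \<phi> (x * (f * r) * y) = 0"
      using *[rule_format, of "x * r" y] *[rule_format, of x "r * y"] by (simp_all add: mult.assoc)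
  qed (simp_all add: flin_0[OF lin] distrib_left distrib_right flin_add[OF lin])
  moreover have "closed N"
  proof (rule closed_fpsI)
    fix f assume f: "\<And>k. \<exists>g. f - fps_X ^ k * g \<in> N"
    have "fps_ext_lin \<phi> (x * f * y) = 0" for x y
    proof (rule hbar_divisible_eq_0)
      fix k
      obtain g where "f - fps_X ^ k * g \<in> N" using f by blast
      hence "fps_ext_lin \<phi> (x * (f - fps_X ^ k * g) * y) = 0" by (simp add: N_def)
      moreover have "x * (f - fps_X ^ k * g) * y = x * f * y - fps_X ^ k * (x * g * y)"
        by (simp add: algebra_simps fps_mult_fps_X_power_commute)
      ultimately have "fps_ext_lin \<phi> (x * f * y) = fps_ext_lin \<phi> (fps_X ^ k * (x * g * y))"
        by (simp add: flin_diff[OF lin])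
      also have "\<dots> = hbar ^ k * fps_ext_lin \<phi> (x * g * y)"
        by (induction k) (simp_all add: mult.assoc flin_X[OF lin])
      finally show "\<exists>z. fps_ext_lin \<phi> (x * f * y) = hbar ^ k * z" by blast
    qed
    thus "f \<in> N" by (simp add: N_def)
  qed
  moreover have "relators \<subseteq> N"
  proof
    fix r :: "'a salg fps" assume r: "r \<in> relators"
    have "fps_ext_lin \<phi> (fps_const (basis_vec a) * r * y) = 0" for a y
      by (rule flin_eqI[OF flin_mult_left[OF lin] flin_zero])
        (use assms(1) r in \<open>simp add: kills_relators_def\<close>)
    hence *: "fps_ext_lin \<phi> (fps_const (basis_vec a) * (r * y)) = 0" for a y
      by (simp add: mult.assoc)
    have "fps_ext_lin \<phi> (x * (r * y)) = 0" for x y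
      by (rule flin_eqI[OF flin_mult_right[OF lin] flin_zero]) (rule *)
    thus "r \<in> N" by (simp add: N_def mult.assoc)
  qed
  ultimately have "rel_ideal \<subseteq> N" unfolding rel_ideal_def by blast
  with assms(2) have "f \<in> N" by blast
  hence "fps_ext_lin \<phi> (1 * f * 1) = 0" unfolding N_def by blast
  thus ?thesis by simp
qed

lemma lin_ext_abs_halg:
  assumes "kills_relators \<phi>"
  shows "lin_ext \<phi> (abs_halg f) = fps_ext_lin \<phi> f"
proof -
  have "rep_halg (abs_halg f) - f \<in> rel_ideal"
    using Quotient_rep_abs[OF Quotient_halg, of f] by (simp add: rel_ideal_zero)
  from fps_ext_lin_rel_ideal[OF assms this] show ?thesis
    by (simp add: lin_ext_eq flin_diff[OF flin_fps_ext_lin])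
qed

lemma lin_ext_hbasis: "kills_relators \<phi> \<Longrightarrow> lin_ext \<phi> (hbasis a) = \<phi> a"
  by (simp add: hbasis_def lin_ext_abs_halg)

lemma hlin_lin_ext:
  assumes "kills_relators \<phi>"
  shows "hlin (lin_ext \<phi>)"
  unfolding hlin_def
proof (intro conjI allI)
  show "lin_ext \<phi> (x + y) = lin_ext \<phi> x + lin_ext \<phi> y" for x y
    by (induction x rule: halg.abs_induct, induction y rule: halg.abs_induct)
      (simp add: plus_halg.abs_eq lin_ext_abs_halg[OF assms] flin_add[OF flin_fps_ext_lin])
  show "lin_ext \<phi> (hscalar c * x) = hscalar c * lin_ext \<phi> x" for c x
    by (induction x rule: halg.abs_induct)
      (simp add: hscalar_def [where 'a = 'a] times_halg.abs_eq lin_ext_abs_halg[OF assms]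
        flin_scalar[OF flin_fps_ext_lin])
qed

text \<open>Compatibility with the product of basis vectors, whose structure constants are the signs
  \<open>bsgn\<close>; on a tensor product this encodes the Koszul rule.\<close>

definition multiplicative :: "('a::presented \<Rightarrow> 'b::presented halg) \<Rightarrow> bool" where
  "multiplicative \<phi> \<longleftrightarrow> \<phi> bone = 1 \<and>
     (\<forall>a b. \<phi> a * \<phi> b = hscalar (fps_const (bsgn a b)) * \<phi> (bmul a b))"

lemma fps_ext_lin_basis_mult:
  "fps_ext_lin \<phi> (fps_const (basis_vec a) * fps_const (basis_vec b)) =
     hscalar (fps_const (bsgn a b)) * \<phi> (bmul a b)"
  using flin_const_scalar[OF flin_fps_ext_lin, of \<phi> "bsgn a b" "fps_const (basis_vec (bmul a b))"]
  by (simp add: basis_vec_mult)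

lemma fps_ext_lin_mult:
  assumes "multiplicative \<phi>"
  shows "fps_ext_lin \<phi> (f * g) = fps_ext_lin \<phi> f * fps_ext_lin \<phi> g"
proof -
  note lin = flin_fps_ext_lin[of \<phi>]
  have *: "fps_ext_lin \<phi> (fps_const (basis_vec a) * g) = \<phi> a * fps_ext_lin \<phi> g" for a
    by (rule flin_eqI[OF flin_mult_left[OF lin] flin_hlin[OF hlin_mult_left lin]])
      (use assms in \<open>simp only: fps_ext_lin_basis_mult fps_ext_lin_basis multiplicative_def\<close>)
  show ?thesis
    by (rule flin_eqI[OF flin_mult_right[OF lin] flin_hlin[OF hlin_mult_right lin]]) (simp add: *)
qed

lemma multiplicative_kills_relators:
  assumes "multiplicative \<phi>" "\<And>r. r \<in> relators \<Longrightarrow> fps_ext_lin \<phi> r = 0"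
  shows "kills_relators \<phi>"
  unfolding kills_relators_def using assms by (simp add: fps_ext_lin_mult)

definition halg_hom :: "('a::presented halg \<Rightarrow> 'b::presented halg) \<Rightarrow> bool" where
  "halg_hom L \<longleftrightarrow> hlin L \<and> L 1 = 1 \<and> (\<forall>x y. L (x * y) = L x * L y)"

lemma halg_hom_lin: "halg_hom L \<Longrightarrow> hlin L"
  and halg_hom_1: "halg_hom L \<Longrightarrow> L 1 = 1"
  and halg_hom_mult: "halg_hom L \<Longrightarrow> L (x * y) = L x * L y"
  by (simp_all add: halg_hom_def)

lemma hbasis_bone [simp]: "hbasis bone = 1"
  by (simp add: hbasis_def one_halg.abs_eq)

lemma hbasis_mult: "hbasis a * hbasis b = hscalar (fps_const (bsgn a b)) * hbasis (bmul a b)"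
  by (simp add: hbasis_def times_halg.abs_eq basis_vec_mult hscalar_def scalar_fps_const)

lemma halg_hom_lin_ext:
  assumes "multiplicative \<phi>" "\<And>r. r \<in> relators \<Longrightarrow> fps_ext_lin \<phi> r = 0"
  shows "halg_hom (lin_ext \<phi>)"
proof -
  note k = multiplicative_kills_relators[OF assms]
  have "lin_ext \<phi> (x * y) = lin_ext \<phi> x * lin_ext \<phi> y" for x y
    by (induction x rule: halg.abs_induct, induction y rule: halg.abs_induct)
      (simp add: times_halg.abs_eq lin_ext_abs_halg[OF k] fps_ext_lin_mult[OF assms(1)])
  moreover have "lin_ext \<phi> 1 = 1"
    using lin_ext_hbasis[OF k, of bone] assms(1) by (simp add: multiplicative_def)
  ultimately show ?thesis by (simp add: halg_hom_def hlin_lin_ext[OF k])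
qed

section \<open>Exponentials\<close>

definition div_power :: "'a::presented halg \<Rightarrow> nat \<Rightarrow> 'a halg" where
  "div_power x n = hscalar (fps_const (1 / fact n)) * x ^ n"

lemma hexp_eq: "hexp x = hseries (div_power x)"
  by (simp add: hexp_def div_power_def [abs_def])

lemma halg_hom_power: "halg_hom L \<Longrightarrow> L (x ^ n) = L x ^ n"
  by (induction n) (simp_all add: halg_hom_def)

lemma halg_hom_hexp: "halg_hom L \<Longrightarrow> L (hexp x) = hexp (L x)"
  by (simp add: hexp_def hlin_hseries hlin_hscalar halg_hom_lin halg_hom_power)

text \<open>The source of the exchange rules for \<open>t\<close> and \<open>Upsilon\<close>: moving
  a polynomial x in the Cartan elements past a weight vector y shifts it to some x', and all powers
  shift alike.\<close>

lemma hexp_conj: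
  assumes "x * y = y * x'"
  shows "hexp x * y = y * hexp x'"
proof -
  have "x ^ n * y = y * x' ^ n" for n
  proof (induction n)
    case (Suc n)
    have "x ^ Suc n * y = x * (y * x' ^ n)" by (simp add: mult.assoc Suc.IH)
    also have "\<dots> = y * x' ^ Suc n" by (simp add: mult.assoc [symmetric] assms)
    finally show ?case .
  qed simp
  thus ?thesis
    by (simp add: hexp_def hseries_mult_left hseries_mult_right mult.assoc hscalar_left_commute)
qed

lemma hexp_commute: "x * y = y * x \<Longrightarrow> hexp x * y = y * hexp x"
  by (rule hexp_conj)

text \<open>Peeling the first term of f off both sides leaves the same claim for the shifted f,
  times \<open>hbar\<close>, while g stays fixed.\<close>

lemma hseries_mult: "hseries f * hseries g = hseries (\<lambda>n. \<Sum>i\<le>n. f i * g (n - i))"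
proof -
  define C where "C f n = (\<Sum>i\<le>n. f i * g (n - i))" for f and n :: nat
  define A where "A f = hseries f * hseries g - hseries (C f)" for f
  have "A f = hbar * A (\<lambda>n. f (Suc n))" for f
  proof -
    have "hseries (C f) = f 0 * g 0 + hbar * hseries (\<lambda>n. f 0 * g (Suc n) + C (\<lambda>n. f (Suc n)) n)"
      by (subst hseries_Suc) (simp add: C_def sum.atMost_Suc_shift del: sum.atMost_Suc)
    also have "\<dots> = f 0 * (g 0 + hbar * hseries (\<lambda>n. g (Suc n))) + hbar * hseries (C (\<lambda>n. f (Suc n)))"
      by (simp add: hseries_add hseries_mult_left [symmetric] algebra_simps hscalar_left_commute)
    also have "\<dots> = f 0 * hseries g + hbar * hseries (C (\<lambda>n. f (Suc n)))"
      by (simp add: hseries_Suc[of g])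
    finally show ?thesis using hseries_Suc[of f] by (simp add: A_def algebra_simps)
  qed
  hence "A f = 0" by (intro hbar_peel[where A = A]) blast
  thus ?thesis by (simp add: A_def C_def [abs_def])
qed

lemma div_power_0 [simp]: "div_power x 0 = 1"
  by (simp add: div_power_def)

lemma div_power_Suc: "hscalar (of_nat (Suc n)) * div_power x (Suc n) = x * div_power x n"
proof -
  have "of_nat (Suc n) * (1 / fact (Suc n)) = (1 / fact n :: complex)"
    by (simp add: field_simps del: of_nat_Suc)
  hence "of_nat (Suc n) * fps_const (1 / fact (Suc n)) = (fps_const (1 / fact n) :: complex fps)"
    by (metis fps_const_mult fps_of_nat)
  thus ?thesis
    by (simp add: div_power_def mult.assoc [symmetric] hscalar_mult [symmetric] del: of_nat_Suc fact_Suc)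
      (simp add: mult.assoc hscalar_left_commute)
qed

lemma hscalar_of_nat_cancel:
  assumes "hscalar (of_nat (Suc n)) * x = hscalar (of_nat (Suc n)) * y"
  shows "x = y"
proof -
  have "fps_const (1 / of_nat (Suc n)) * of_nat (Suc n) = (1 :: complex fps)"
    by (simp add: fps_of_nat [symmetric] del: of_nat_Suc)
  hence "hscalar (fps_const (1 / of_nat (Suc n))) * (hscalar (of_nat (Suc n)) * x) = x" for x :: "'a halg"
    by (simp only: mult.assoc [symmetric] hscalar_mult [symmetric]) simp
  with assms show ?thesis by metis
qed

lemma div_power_commute: "x * y = y * x \<Longrightarrow> div_power x n * y = y * div_power x n"
  by (simp add: div_power_def mult.assoc hscalar_left_commute power_commuting_commutes)

text \<open>The binomial theorem for divided powers. In the induction the factor n + 1 is split as i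
  + (n + 1 - i), and each part lowers one divided power by \<open>div_power_Suc\<close>; at the end
  n + 1 is cancelled, being invertible in \<complex>.\<close>

lemma div_power_add:
  assumes "x * y = y * x"
  shows "div_power (x + y) n = (\<Sum>i\<le>n. div_power x i * div_power y (n - i))"
proof (induction n)
  case (Suc n)
  let ?S = "\<lambda>n. \<Sum>i\<le>n. div_power x i * div_power y (n - i)"
  have "hscalar (of_nat (Suc n)) * ?S (Suc n) =
      (\<Sum>i\<le>Suc n. (hscalar (of_nat i) * div_power x i) * div_power y (Suc n - i) +
         div_power x i * (hscalar (of_nat (Suc n - i)) * div_power y (Suc n - i)))"
    unfolding sum_distrib_left
  proof (rule sum.cong[OF refl])
    fix i assume "i \<in> {..Suc n}"
    hence "of_nat (Suc n) = (of_nat i + of_nat (Suc n - i) :: complex fps)"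
      by (simp add: of_nat_add [symmetric] del: of_nat_add of_nat_Suc)
    thus "hscalar (of_nat (Suc n)) * (div_power x i * div_power y (Suc n - i)) =
       (hscalar (of_nat i) * div_power x i) * div_power y (Suc n - i) +
         div_power x i * (hscalar (of_nat (Suc n - i)) * div_power y (Suc n - i))"
      by (simp add: hscalar_add distrib_right mult.assoc hscalar_left_commute)
  qed
  also have "\<dots> = (\<Sum>i\<le>Suc n. (hscalar (of_nat i) * div_power x i) * div_power y (Suc n - i)) +
      (\<Sum>i\<le>Suc n. div_power x i * (hscalar (of_nat (Suc n - i)) * div_power y (Suc n - i)))"
    by (rule sum.distrib)
  also have "(\<Sum>i\<le>Suc n. (hscalar (of_nat i) * div_power x i) * div_power y (Suc n - i)) = x * ?S n"
    by (simp add: sum.atMost_Suc_shift div_power_Suc sum_distrib_left del: sum.atMost_Suc of_nat_Suc)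
      (simp add: mult.assoc)
  also have "(\<Sum>i\<le>Suc n. div_power x i * (hscalar (of_nat (Suc n - i)) * div_power y (Suc n - i))) =
      (\<Sum>i\<le>n. div_power x i * (y * div_power y (n - i)))"
    by (auto intro!: sum.cong simp: Suc_diff_le div_power_Suc simp del: of_nat_Suc of_nat_diff)
  also have "\<dots> = y * ?S n"
    using div_power_commute[OF assms] by (simp add: sum_distrib_left mult.assoc [symmetric])
  also have "x * ?S n + y * ?S n = hscalar (of_nat (Suc n)) * div_power (x + y) (Suc n)"
    by (simp only: div_power_Suc Suc.IH distrib_right)
  finally show ?case by (metis hscalar_of_nat_cancel)
qed simp

lemma hexp_add: "x * y = y * x \<Longrightarrow> hexp (x + y) = hexp x * hexp y"
  unfolding hexp_eq hseries_mult by (intro arg_cong[of _ _ hseries] ext div_power_add)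

lemma hexp_0 [simp]: "hexp 0 = 1"
proof -
  have "div_power (0 :: 'a halg) (Suc n) = 0" for n by (simp add: div_power_def)
  thus ?thesis unfolding hexp_eq by (subst hseries_Suc) simp
qed

lemma hexp_minus: "hexp x * hexp (- x) = 1" "hexp (- x) * hexp x = 1"
  using hexp_add[of x "- x"] hexp_add[of "- x" x] by simp_all

text \<open>\<open>hsinh2 x\<close> is \<open>(e\<^bsup>\<hbar>x\<^esup> - e\<^bsup>-\<hbar>x\<^esup>) / \<hbar>\<close>.\<close>

definition hsinh2 :: "'a::presented halg \<Rightarrow> 'a halg" where
  "hsinh2 x = hseries (\<lambda>n. div_power x (Suc n) - div_power (- x) (Suc n))"

lemma hseries_diff: "hseries (\<lambda>n. x n - y n) = hseries x - hseries y"
proof -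
  have "hseries (\<lambda>n. - y n) = - hseries y"
    using hseries_mult_left[of "- 1" y] by simp
  thus ?thesis using hseries_add[of x "\<lambda>n. - y n"] by simp
qed

lemma hbar_hsinh2: "hbar * hsinh2 x = hexp x - hexp (- x)"
  unfolding hexp_eq using hseries_Suc[of "div_power x"] hseries_Suc[of "div_power (- x)"]
  by (simp add: hsinh2_def hseries_diff right_diff_distrib)

lemma hsinh2_uminus: "hsinh2 (- x) = - hsinh2 x"
  by (simp add: hsinh2_def hseries_diff)

text \<open>After multiplication by \<open>hbar\<close> this is an evident identity of exponentials,
  but \<open>hbar\<close> may fail to be cancellable. The identity is therefore checked on
  coefficients, where the contributions of x - y from the two summands cancel.\<close>

lemma hsinh2_add:
  assumes "x * y = y * x"
  shows "hsinh2 (x + y) = hsinh2 x * hexp (- y) + hexp x * hsinh2 y"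
proof -
  let ?e = div_power
  have "(\<Sum>i\<le>n. (?e x (Suc i) - ?e (- x) (Suc i)) * ?e (- y) (n - i)) =
      ?e (x - y) (Suc n) - ?e (- (x + y)) (Suc n)" for n
  proof -
    \<comment> \<open>The added term i = 0 vanishes because both divided powers of degree 0 are 1,
      and what results is a full convolution. In the second sum it is the added last term that
      vanishes.\<close>
    have "(\<Sum>i\<le>n. (?e x (Suc i) - ?e (- x) (Suc i)) * ?e (- y) (n - i)) =
        (\<Sum>i\<le>Suc n. (?e x i - ?e (- x) i) * ?e (- y) (Suc n - i))"
      by (simp add: sum.atMost_Suc_shift del: sum.atMost_Suc)
    also have "\<dots> = ?e (x - y) (Suc n) - ?e (- (x + y)) (Suc n)"
      using div_power_add[of x "- y" "Suc n"] div_power_add[of "- x" "- y" "Suc n"] assms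
      by (simp add: left_diff_distrib sum_subtractf del: sum.atMost_Suc)
    finally show ?thesis .
  qed
  moreover have "(\<Sum>i\<le>n. ?e x i * (?e y (Suc (n - i)) - ?e (- y) (Suc (n - i)))) =
      ?e (x + y) (Suc n) - ?e (x - y) (Suc n)" for n
  proof -
    have "(\<Sum>i\<le>n. ?e x i * (?e y (Suc (n - i)) - ?e (- y) (Suc (n - i)))) =
        (\<Sum>i\<le>Suc n. ?e x i * (?e y (Suc n - i) - ?e (- y) (Suc n - i)))"
      by (simp add: Suc_diff_le)
    also have "\<dots> = ?e (x + y) (Suc n) - ?e (x - y) (Suc n)"
      using div_power_add[of x y "Suc n"] div_power_add[of x "- y" "Suc n"] assms
      by (simp add: right_diff_distrib sum_subtractf del: sum.atMost_Suc)
    finally show ?thesis .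
  qed
  ultimately show ?thesis
    by (simp add: hsinh2_def hexp_eq hseries_mult hseries_add [symmetric])
qed

section \<open>The tensor product and the flip\<close>

lemma map_basis_superset:
  assumes "finite A" "Poly_Mapping.keys (vec s) \<subseteq> A"
  shows "map_basis h s = (\<Sum>a\<in>A. scalar (Poly_Mapping.lookup (vec s) a) * basis_vec (h a))"
proof -
  have "map_basis h s = (\<Sum>a\<in>Poly_Mapping.keys (vec s). scalar (Poly_Mapping.lookup (vec s) a) * basis_vec (h a))"
    by (simp add: map_basis_def of_vec_sum basis_vec_def scalar_def times_salg.abs_eq eq_onp_def smul_single)
  also have "\<dots> = (\<Sum>a\<in>A. scalar (Poly_Mapping.lookup (vec s) a) * basis_vec (h a))"
    by (rule sum.mono_neutral_left) (use assms in \<open>auto simp: in_keys_iff\<close>)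
  finally show ?thesis .
qed

lemma map_basis_add: "map_basis h (s + t) = map_basis h s + map_basis h (t :: 'a salg)"
  for h :: "'a \<Rightarrow> 'b::superbasis"
proof -
  let ?A = "Poly_Mapping.keys (vec s) \<union> Poly_Mapping.keys (vec t) \<union> Poly_Mapping.keys (vec (s + t))"
  have *: "finite ?A" by simp
  show ?thesis
    by (subst (1 2 3) map_basis_superset[OF *])
      (auto simp: plus_salg.rep_eq lookup_add scalar_add distrib_right sum.distrib)
qed

lemma map_basis_scalar: "map_basis h (scalar c * s) = scalar c * map_basis h s"
proof -
  have *: "Poly_Mapping.keys (vec (scalar c * s)) \<subseteq> Poly_Mapping.keys (vec s)"
    by (auto simp: in_keys_iff lookup_scalar_mult)
  show ?thesis
    by (subst map_basis_superset[OF _ *], simp, subst map_basis_superset[OF _ order_refl])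
      (auto simp: lookup_scalar_mult sum_distrib_left scalar_mult mult.assoc)
qed

lemma map_basis_basis [simp]: "map_basis h (basis_vec a) = basis_vec (h a :: 'b::superbasis)"
  by (subst map_basis_superset[of "{a}"]) (auto simp: basis_vec_def of_vec_inverse)

lemma map_basis_0 [simp]: "map_basis h 0 = (0 :: 'b::superbasis salg)"
  using map_basis_add[of h 0 0] by simp

lemma flin_map_basis_fps:
  assumes "flin L"
  shows "flin (\<lambda>f. L (map_basis_fps h f))"
proof (rule flinI)
  fix x y :: "'c salg fps" and c
  have "map_basis_fps h (x + y) = map_basis_fps h x + map_basis_fps h y"
    by (simp add: map_basis_fps_def fps_eq_iff map_basis_add)
  thus "L (map_basis_fps h (x + y)) = L (map_basis_fps h x) + L (map_basis_fps h y)"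
    by (simp add: flin_add[OF assms])
  have "map_basis_fps h (fps_const (scalar c) * x) = fps_const (scalar c) * map_basis_fps h x"
    by (simp add: map_basis_fps_def fps_eq_iff map_basis_scalar)
  thus "L (map_basis_fps h (fps_const (scalar c) * x)) = hscalar (fps_const c) * L (map_basis_fps h x)"
    by (simp add: flin_const_scalar[OF assms])
  have "map_basis_fps h (fps_X * x) = fps_X * map_basis_fps h x"
    by (simp add: map_basis_fps_def fps_eq_iff)
  thus "L (map_basis_fps h (fps_X * x)) = hbar * L (map_basis_fps h x)"
    by (simp add: flin_X[OF assms])
qed

lemma map_basis_fps_basis [simp]:
  "map_basis_fps h (fps_const (basis_vec a)) = fps_const (basis_vec (h a :: 'b::superbasis))"
  by (simp add: map_basis_fps_def fps_eq_iff)

lemma fps_ext_lin_map_basis_fps: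
  "fps_ext_lin \<phi> (map_basis_fps h f) = fps_ext_lin (\<lambda>a. \<phi> (h a)) f"
  by (rule flin_eqI[OF flin_map_basis_fps[OF flin_fps_ext_lin] flin_fps_ext_lin]) simp

lemma abs_halg_eq: "abs_halg f = fps_ext_lin hbasis f"
  by (rule flin_eqI[OF flin_abs_halg flin_fps_ext_lin]) (simp add: hbasis_def)

text \<open>The maps x \<mapsto> x \<otimes> 1 and, below, y \<mapsto> 1 \<otimes> y. Through
  \<open>tensor_eq\<close> a tensor becomes a product, so calculations in the tensor square become
  rewriting of words in two sets of generators.\<close>

definition emb1 :: "'a::presented halg \<Rightarrow> ('a \<times> 'b::presented) halg" where
  "emb1 = lin_ext (\<lambda>a. hbasis (a, bone))"

definition emb2 :: "'b::presented halg \<Rightarrow> ('a::presented \<times> 'b) halg" where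
  "emb2 = lin_ext (\<lambda>b. hbasis (bone, b))"

lemma tensor_eq: "x \<otimes>\<^sub>h y = emb1 x * emb2 y"
  unfolding tensor_def times_halg.abs_eq [symmetric]
  by (simp add: abs_halg_eq fps_ext_lin_map_basis_fps emb1_def emb2_def lin_ext_eq)

lemma fps_ext_lin_relator [simp]:
  "r \<in> relators \<Longrightarrow> fps_ext_lin hbasis r = 0"
  by (simp add: abs_halg_eq [symmetric] abs_halg_eq_0_iff relators_rel_ideal)

lemma fps_ext_lin_emb_relator:
  "r \<in> relators \<Longrightarrow> fps_ext_lin (\<lambda>a. hbasis (a, bone)) r = 0"
  "r \<in> relators \<Longrightarrow> fps_ext_lin (\<lambda>b. hbasis (bone, b)) r = 0"
proof -
  assume r: "r \<in> relators"
  have "fps_ext_lin hbasis (map_basis_fps (\<lambda>a. (a, bone)) r) = 0"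
    by (rule fps_ext_lin_relator) (simp add: relators_prod_def r)
  thus "fps_ext_lin (\<lambda>a. hbasis (a, bone)) r = 0" by (simp add: fps_ext_lin_map_basis_fps)
next
  assume r: "r \<in> relators"
  have "fps_ext_lin hbasis (map_basis_fps (\<lambda>b. (bone, b)) r) = 0"
    by (rule fps_ext_lin_relator) (simp add: relators_prod_def r)
  thus "fps_ext_lin (\<lambda>b. hbasis (bone, b)) r = 0" by (simp add: fps_ext_lin_map_basis_fps)
qed

lemma emb1_multiplicative:
  "multiplicative (\<lambda>a::'a::presented. hbasis (a, bone :: 'b::presented))"
  by (simp add: multiplicative_def hbasis_mult bone_prod_def [symmetric] bsgn_prod_def bmul_prod_def)

lemma emb2_multiplicative:
  "multiplicative (\<lambda>b::'b::presented. hbasis (bone :: 'a::presented, b))"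
  by (simp add: multiplicative_def hbasis_mult bone_prod_def [symmetric] bsgn_prod_def bmul_prod_def)

lemma halg_hom_emb1: "halg_hom emb1"
  unfolding emb1_def by (intro halg_hom_lin_ext emb1_multiplicative fps_ext_lin_emb_relator)

lemma halg_hom_emb2: "halg_hom emb2"
  unfolding emb2_def by (intro halg_hom_lin_ext emb2_multiplicative fps_ext_lin_emb_relator)

lemma emb1_hbasis: "emb1 (hbasis a) = hbasis (a, bone)"
  unfolding emb1_def
  by (intro lin_ext_hbasis multiplicative_kills_relators emb1_multiplicative fps_ext_lin_emb_relator)

lemma emb2_hbasis: "emb2 (hbasis a) = hbasis (bone, a)"
  unfolding emb2_def
  by (intro lin_ext_hbasis multiplicative_kills_relators emb2_multiplicative fps_ext_lin_emb_relator)

lemma emb1_emb2_hbasis: "emb1 (hbasis a) * emb2 (hbasis b) = hbasis (a, b)"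
  by (simp add: emb1_hbasis emb2_hbasis hbasis_mult bsgn_prod_def bmul_prod_def)

lemma emb2_emb1_hbasis:
  "emb2 (hbasis b) * emb1 (hbasis a) = (- 1) ^ (bpar a * bpar b) * (emb1 (hbasis a) * emb2 (hbasis b))"
  unfolding emb1_emb2_hbasis
  by (simp add: emb1_hbasis emb2_hbasis hbasis_mult bsgn_prod_def bmul_prod_def neg_one_power
      mult.commute[of "bpar a"])

lemma multiplicative_flip:
  "multiplicative (\<lambda>(a :: 'a::presented, b :: 'b::presented). (- 1) ^ (bpar a * bpar b) * hbasis (b, a))"
  unfolding multiplicative_def
proof (intro conjI allI; clarify?)
  fix a c :: 'a and b d :: 'b
  \<comment> \<open>Expanding (|a| + |c|)(|b| + |d|) yields |b||c| once, and the Koszul sign in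
    front cancels it.\<close>
  have sgn: "(- 1) ^ (bpar a * bpar b) * (- 1) ^ (bpar c * bpar d) * (- 1) ^ (bpar a * bpar d) =
      (- 1) ^ (bpar b * bpar c) * ((- 1) ^ ((bpar a + bpar c) * (bpar b + bpar d)) :: complex)"
    unfolding power_add [symmetric] by (simp add: minus_one_power_iff) blast
  have mm: "hscalar p * x * (hscalar p' * y) = hscalar (p * p') * (x * y)" for p p' and x y :: "('b \<times> 'a) halg"
    by (simp only: hscalar_mult mult.assoc hscalar_left_commute[of x])
  have "(- 1) ^ (bpar a * bpar b) * hbasis (b, a) * ((- 1) ^ (bpar c * bpar d) * hbasis (d, c)) =
      hscalar (fps_const ((- 1) ^ (bpar a * bpar b) * (- 1) ^ (bpar c * bpar d) *
        ((- 1) ^ (bpar a * bpar d) * bsgn b d * bsgn a c))) * hbasis (bmul b d, bmul a c)"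
    unfolding neg_one_power mm hbasis_mult
    by (simp add: bsgn_prod_def bmul_prod_def mult.assoc [symmetric] hscalar_mult [symmetric])
  also have "(- 1) ^ (bpar a * bpar b) * (- 1) ^ (bpar c * bpar d) *
        ((- 1) ^ (bpar a * bpar d) * bsgn b d * bsgn a c) =
      bsgn (a, b) (c, d) * (- 1) ^ ((bpar a + bpar c) * (bpar b + bpar d))"
    using arg_cong[OF sgn, of "\<lambda>s. s * bsgn b d * bsgn a c"] by (simp add: bsgn_prod_def mult_ac)
  finally show "(- 1) ^ (bpar a * bpar b) * hbasis (b, a) * ((- 1) ^ (bpar c * bpar d) * hbasis (d, c)) =
     hscalar (fps_const (bsgn (a, b) (c, d))) *
      (case bmul (a, b) (c, d) of (a, b) \<Rightarrow> (- 1) ^ (bpar a * bpar b) * hbasis (b, a))"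
    unfolding neg_one_power fps_const_mult [symmetric] hscalar_mult mult.assoc
    by (simp add: bmul_prod_def)
qed (use hbasis_bone[where 'a = "'b \<times> 'a"] in \<open>simp add: bone_prod_def del: hbasis_bone\<close>)

lemma fps_ext_lin_flip_relator:
  assumes "r \<in> relators"
  shows "fps_ext_lin (\<lambda>(a :: 'a::presented, b :: 'b::presented). (- 1) ^ (bpar a * bpar b) * hbasis (b, a)) r = 0"
  using assms unfolding relators_prod_def
  by (auto simp: fps_ext_lin_map_basis_fps fps_ext_lin_emb_relator)

lemma halg_hom_flip: "halg_hom flip"
  unfolding flip_def by (intro halg_hom_lin_ext multiplicative_flip fps_ext_lin_flip_relator)

lemma flip_hbasis: "flip (hbasis (a, b)) = (- 1) ^ (bpar a * bpar b) * hbasis (b, a)"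
  unfolding flip_def
  by (subst lin_ext_hbasis)
    (auto intro!: multiplicative_kills_relators multiplicative_flip fps_ext_lin_flip_relator)

lemma flip_emb1: "flip (emb1 x) = emb2 x"
  by (rule hlin_eqI[OF hlin_comp[OF halg_hom_lin[OF halg_hom_flip] halg_hom_lin[OF halg_hom_emb1]]
        halg_hom_lin[OF halg_hom_emb2]])
    (simp add: emb1_hbasis emb2_hbasis flip_hbasis)

lemma flip_emb2: "flip (emb2 x) = emb1 x"
  by (rule hlin_eqI[OF hlin_comp[OF halg_hom_lin[OF halg_hom_flip] halg_hom_lin[OF halg_hom_emb2]]
        halg_hom_lin[OF halg_hom_emb1]])
    (simp add: emb1_hbasis emb2_hbasis flip_hbasis)

section \<open>Homogeneous elements\<close>

text \<open>Only the parity of \<open>p\<close> matters, and zero has every degree. Natural numbers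
  serve as parities so that degrees of products simply add.\<close>

definition salg_homog :: "nat \<Rightarrow> 'a::superbasis salg \<Rightarrow> bool" where
  "salg_homog p s \<longleftrightarrow> (\<forall>a\<in>Poly_Mapping.keys (vec s). even (bpar a + p))"

definition fps_homog :: "nat \<Rightarrow> 'a::superbasis salg fps \<Rightarrow> bool" where
  "fps_homog p f \<longleftrightarrow> (\<forall>n. salg_homog p (fps_nth f n))"

lemma salg_homog_0 [simp]: "salg_homog p 0"
  by (simp add: salg_homog_def zero_salg.rep_eq)

lemma salg_homog_add: "salg_homog p s \<Longrightarrow> salg_homog p t \<Longrightarrow> salg_homog p (s + t)"
  using Poly_Mapping.keys_add[of "vec s" "vec t"] by (auto simp: salg_homog_def plus_salg.rep_eq)

lemma salg_homog_uminus: "salg_homog p s \<Longrightarrow> salg_homog p (- s)"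
  by (simp add: salg_homog_def uminus_salg.rep_eq)

lemma salg_homog_sum: "(\<And>i. i \<in> I \<Longrightarrow> salg_homog p (f i)) \<Longrightarrow> salg_homog p (sum f I)"
  by (induction I rule: infinite_finite_induct) (simp_all add: salg_homog_add)

lemma salg_homog_basis: "even (bpar a + p) \<Longrightarrow> salg_homog p (basis_vec a)"
  by (simp add: salg_homog_def basis_vec_def of_vec_inverse)

lemma salg_homog_scalar: "salg_homog 0 (scalar c)"
  by (simp add: salg_homog_def scalar_def of_vec_inverse)

lemma salg_homog_mult:
  assumes "salg_homog p s" "salg_homog q t"
  shows "salg_homog (p + q) (s * t)"
proof -
  have *: "salg_homog (p + q) (scalar c * basis_vec a * (scalar d * basis_vec b))"
    if "even (bpar a + p)" "even (bpar b + q)" for a b :: 'a and c d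
  proof -
    have "vec (scalar c * basis_vec a * (scalar d * basis_vec b)) =
        Poly_Mapping.single (bmul a b) (bsgn a b * c * d)"
      by (simp add: scalar_def basis_vec_def times_salg.rep_eq of_vec_inverse smul_single)
    thus ?thesis using that by (auto simp: salg_homog_def)
  qed
  have "s * t = (\<Sum>a\<in>Poly_Mapping.keys (vec s). \<Sum>b\<in>Poly_Mapping.keys (vec t).
      scalar (Poly_Mapping.lookup (vec s) a) * basis_vec a *
      (scalar (Poly_Mapping.lookup (vec t) b) * basis_vec b))"
    using arg_cong2[OF salg_expand[of s] salg_expand[of t], of "(*)"] by (simp only: sum_product)
  also have "salg_homog (p + q) \<dots>"
    by (intro salg_homog_sum *) (use assms in \<open>simp_all add: salg_homog_def\<close>)
  finally show ?thesis .
qed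

lemma salg_homog_power: "salg_homog 0 s \<Longrightarrow> salg_homog 0 (s ^ n)"
proof (induction n)
  case (Suc n)
  thus ?case using salg_homog_mult[of 0 s 0 "s ^ n"] by simp
qed (use salg_homog_scalar[of 1] in simp)

lemma fps_homog_add: "fps_homog p f \<Longrightarrow> fps_homog p g \<Longrightarrow> fps_homog p (f + g)"
  by (simp add: fps_homog_def salg_homog_add)

lemma fps_homog_diff: "fps_homog p f \<Longrightarrow> fps_homog p g \<Longrightarrow> fps_homog p (f - g)"
  unfolding diff_conv_add_uminus[of f g]
  by (intro fps_homog_add) (simp_all add: fps_homog_def salg_homog_uminus)

lemma fps_homog_mult: "fps_homog p f \<Longrightarrow> fps_homog q g \<Longrightarrow> fps_homog (p + q) (f * g)"
  by (auto simp: fps_homog_def fps_mult_nth intro!: salg_homog_sum salg_homog_mult)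

lemma fps_homog_const: "salg_homog p s \<Longrightarrow> fps_homog p (fps_const s)"
  by (simp add: fps_homog_def)

lemma fps_homog_scalar: "fps_homog 0 (scalar_fps c)"
  by (simp add: fps_homog_def salg_homog_scalar)

lemma fps_homog_shift: "fps_homog p f \<Longrightarrow> fps_homog p (fps_shift n f)"
  by (simp add: fps_homog_def)

lemma fps_homog_free_exp: "salg_homog 0 x \<Longrightarrow> fps_homog 0 (free_exp x)"
  by (auto simp: fps_homog_def free_exp_def
      intro!: salg_homog_mult[of 0 _ 0, simplified] salg_homog_scalar salg_homog_power)

lemma fps_homog_parity: "fps_homog p f \<Longrightarrow> even (p + q) \<Longrightarrow> fps_homog q f"
  by (auto simp: fps_homog_def salg_homog_def)

text \<open>All monomials of a homogeneous series have the same parity, so a sign whose exponent is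
  affine in the degree is constant and comes out of the sum. In this way sign-twisted maps are seen
  to kill relators.\<close>

lemma fps_ext_lin_sign:
  assumes "fps_homog p f"
  shows "fps_ext_lin (\<lambda>a. (- 1) ^ (m + k * bpar a) * \<psi> a) f = (- 1) ^ (m + k * p) * fps_ext_lin \<psi> f"
proof -
  have "salg_lin (\<lambda>a. (- 1) ^ (m + k * bpar a) * \<psi> a) s = (- 1) ^ (m + k * p) * salg_lin \<psi> s"
    if "salg_homog p s" for s
  proof -
    have "(- 1) ^ (m + k * bpar a) = ((- 1) ^ (m + k * p) :: complex)"
      if "a \<in> Poly_Mapping.keys (vec s)" for a
      using that \<open>salg_homog p s\<close> by (auto simp: salg_homog_def minus_one_power_iff)
    thus ?thesis
      unfolding salg_lin_def neg_one_power sum_distrib_left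
      by (intro sum.cong) (simp_all add: mult.assoc [symmetric] hscalar_mult [symmetric] mult_ac)
  qed
  thus ?thesis
    using assms by (simp add: fps_ext_lin_def fps_homog_def hseries_mult_left)
qed

lemma even_elemI: "fps_homog 0 f \<Longrightarrow> even_elem (abs_halg f)"
  by (auto simp: even_elem_def fps_homog_def salg_homog_def)

lemma even_elemE:
  assumes "even_elem x"
  obtains f where "x = abs_halg f" "fps_homog 0 f"
  using assms by (auto simp: even_elem_def fps_homog_def salg_homog_def)

lemma even_elem_add: "even_elem x \<Longrightarrow> even_elem y \<Longrightarrow> even_elem (x + y)"
  by (elim even_elemE) (auto simp: plus_halg.abs_eq intro!: even_elemI fps_homog_add)

lemma even_elem_mult: "even_elem x \<Longrightarrow> even_elem y \<Longrightarrow> even_elem (x * y)"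
  by (elim even_elemE)
    (auto simp: times_halg.abs_eq intro!: even_elemI fps_homog_mult[of 0 _ 0, simplified])

lemma even_elem_hscalar: "even_elem (hscalar c)"
  unfolding hscalar_def by (intro even_elemI fps_homog_scalar)

lemma even_elem_hbasis: "even (bpar a) \<Longrightarrow> even_elem (hbasis a)"
  unfolding hbasis_def by (intro even_elemI fps_homog_const salg_homog_basis) simp

lemma even_elem_uminus: "even_elem x \<Longrightarrow> even_elem (- x)"
  using even_elem_mult[OF even_elem_hscalar[of "- 1"], of x] by (simp add: hscalar_uminus)

lemma even_elem_power: "even_elem x \<Longrightarrow> even_elem (x ^ n)"
  using even_elem_hscalar[of 1] by (induction n) (auto intro: even_elem_mult)

text \<open>The representatives inside \<open>hseries\<close> need not be even. Even ones are chosen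
  instead, and peeling shows that the series \<open>W\<close> assembled from them represents the
  same sum.\<close>

lemma even_elem_hseries:
  assumes "\<And>n. even_elem (x n)"
  shows "even_elem (hseries x)"
proof -
  obtain f where f: "\<And>n. x n = abs_halg (f n)" "\<And>n. fps_homog 0 (f n)"
    using assms unfolding even_elem_def fps_homog_def salg_homog_def by (simp, metis)
  define W where "W f = Abs_fps (\<lambda>m. \<Sum>n\<le>m. fps_nth (f n) (m - n))" for f :: "nat \<Rightarrow> 'a salg fps"
  define A where "A f = hseries (\<lambda>n. abs_halg (f n)) - abs_halg (W f)" for f
  have "A f = hbar * A (\<lambda>n. f (Suc n))" for f
  proof -
    have "W f = f 0 + fps_X * W (\<lambda>n. f (Suc n))"
    proof (rule fps_ext)
      fix m
      show "fps_nth (W f) m = fps_nth (f 0 + fps_X * W (\<lambda>n. f (Suc n))) m"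
        by (cases m) (simp_all add: W_def sum.atMost_Suc_shift del: sum.atMost_Suc)
    qed
    hence "abs_halg (W f) = abs_halg (f 0) + hbar * abs_halg (W (\<lambda>n. f (Suc n)))"
      by (simp add: plus_halg.abs_eq times_halg.abs_eq hscalar_def)
    thus ?thesis using hseries_Suc[of "\<lambda>n. abs_halg (f n)"] by (simp add: A_def algebra_simps)
  qed
  hence "A f = 0" by (intro hbar_peel[where A = A]) blast
  hence "hseries x = abs_halg (W f)" by (simp add: A_def f(1) [symmetric])
  moreover have "fps_homog 0 (W f)"
    using f(2) by (auto simp: fps_homog_def W_def intro!: salg_homog_sum)
  ultimately show ?thesis by (simp add: even_elemI)
qed

lemma even_elem_hexp: "even_elem x \<Longrightarrow> even_elem (hexp x)"
  unfolding hexp_def by (intro even_elem_hseries even_elem_mult even_elem_hscalar even_elem_power)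

section \<open>The defining relations\<close>

lemma left_commute_of_commute: "x * y = y * x \<Longrightarrow> x * (y * z) = y * (x * z)"
  for x y z :: "'a::semigroup_mult"
  by (metis mult.assoc)

lemma left_anticommute_of_anticommute: "x * y = - (y * x) \<Longrightarrow> x * (y * z) = - (y * (x * z))"
  for x y z :: "'a::ring"
  by (metis mult.assoc mult_minus_left)

text \<open>The power series (q - 1/q) / \<hbar>; its constant term 2 makes it a unit.\<close>

definition q_diff_div :: "complex fps" where
  "q_diff_div = fps_shift 1 (fps_exp 1 - fps_exp (- 1))"

lemma q_diff_eq: "q_diff = fps_X * q_diff_div"
  by (auto simp: q_diff_def q_diff_div_def fps_eq_iff)

lemma q_diff_div_inverse: "q_diff_div * inverse q_diff_div = 1"
  by (subst mult.commute, rule inverse_mult_eq_1) (simp add: q_diff_div_def)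

text \<open>The relations for an arbitrary quadruple: one set of consequences serves the generators
  and both of their tensor copies, and the coproduct respects the relations by being another
  instance.\<close>

locale gl11_rels =
  fixes e f h1 h2 :: "'a::presented halg"
  assumes h1_h2: "h1 * h2 = h2 * h1"
    and h1_e: "h1 * e = e * h1 + e"
    and h2_e: "h2 * e = e * h2 - e"
    and h1_f: "h1 * f = f * h1 - f"
    and h2_f: "h2 * f = f * h2 + f"
    and e_f: "e * f + f * e = hscalar (inverse q_diff_div) * hsinh2 (h1 + h2)"
    and e_e: "e * e = 0"
    and f_f: "f * f = 0"
begin

definition k where "k = hexp (h1 + h2)"
definition ki where "ki = hexp (- (h1 + h2))"
definition t where "t = hexp (h2 ^ 2 - h1 ^ 2)"

lemma k_ki: "k * ki = 1" "ki * k = 1"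
  by (simp_all only: k_def ki_def hexp_minus)

lemma k_ki_assoc: "k * (ki * x) = x" "ki * (k * x) = x"
  by (simp_all add: mult.assoc [symmetric] k_ki)

lemma k_commute:
  assumes "(h1 + h2) * x = x * (h1 + h2)"
  shows "k * x = x * k" "ki * x = x * ki"
proof -
  show "k * x = x * k" unfolding k_def by (rule hexp_commute[OF assms])
  have "- (h1 + h2) * x = x * - (h1 + h2)" using assms by (simp only: mult_minus_left mult_minus_right)
  thus "ki * x = x * ki" unfolding ki_def by (rule hexp_commute)
qed

lemma k_e: "k * e = e * k" "ki * e = e * ki"
  by (rule k_commute; simp add: distrib_left distrib_right h1_e h2_e)+

lemma k_f: "k * f = f * k" "ki * f = f * ki"
  by (rule k_commute; simp add: distrib_left distrib_right h1_f h2_f)+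

lemma k_h: "k * h1 = h1 * k" "ki * h1 = h1 * ki" "k * h2 = h2 * k" "ki * h2 = h2 * ki"
  by (rule k_commute; simp add: distrib_left distrib_right h1_h2)+

text \<open>Multiplying by \<open>q_diff\<close>, which is \<open>fps_X\<close> times the unit
  \<open>q_diff_div\<close>, clears both denominators. The calculations with v trade FE for EF in
  this form, at the price of a factor \<open>q_diff\<close>.\<close>

lemma q_diff_e_f: "hscalar q_diff * (e * f + f * e) = k - ki"
proof -
  have "hscalar q_diff * (e * f + f * e) =
      hscalar (fps_X * (q_diff_div * inverse q_diff_div)) * hsinh2 (h1 + h2)"
    by (simp only: e_f q_diff_eq hscalar_mult mult.assoc)
  thus ?thesis by (simp only: q_diff_div_inverse mult_1_right hbar_hsinh2 k_def ki_def)
qed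

lemma h1_left:
  "h1 * (h2 * x) = h2 * (h1 * x)" "h1 * (e * x) = e * (h1 * x) + e * x" "h1 * (f * x) = f * (h1 * x) - f * x"
  by (simp_all only: mult.assoc [symmetric] h1_h2 h1_e h1_f distrib_right left_diff_distrib)

lemma h2_left: "h2 * (e * x) = e * (h2 * x) - e * x" "h2 * (f * x) = f * (h2 * x) + f * x"
  by (simp_all only: mult.assoc [symmetric] h2_e h2_f distrib_right left_diff_distrib)

lemmas h_simps = h1_h2 h1_e h1_f h2_e h2_f h1_left h2_left

lemma t_h: "t * h1 = h1 * t" "t * h2 = h2 * t"
  unfolding t_def power2_eq_square by (rule hexp_commute; simp add: algebra_simps h_simps)+

lemma k_t: "t * k = k * t" "t * ki = ki * t"
  unfolding k_def ki_def using t_h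
  by (auto intro!: hexp_commute[symmetric] simp: algebra_simps)

text \<open>Passing e shifts h1 by 1 and h2 by -1, so their squares change by 2 h1 + 1 and -2 h2 +
  1. In the difference the constants cancel and -2 (h1 + h2) remains, whence two factors
  \<open>ki\<close>.\<close>

lemma t_e: "t * e = e * (ki * (ki * t))"
proof -
  let ?b = "- (h1 + h2)"
  have "(h2 ^ 2 - h1 ^ 2) * e = e * ((h2 ^ 2 - h1 ^ 2) + (?b + ?b))"
    by (simp add: power2_eq_square algebra_simps h_simps)
  hence "t * e = e * hexp ((h2 ^ 2 - h1 ^ 2) + (?b + ?b))" unfolding t_def by (rule hexp_conj)
  also have "hexp ((h2 ^ 2 - h1 ^ 2) + (?b + ?b)) = t * hexp (?b + ?b)"
    unfolding t_def
    by (rule hexp_add) (simp add: power2_eq_square algebra_simps h_simps)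
  also have "hexp (?b + ?b) = ki * ki" unfolding ki_def by (rule hexp_add) simp
  finally show ?thesis by (simp add: k_t mult.assoc [symmetric]) (simp add: k_t mult.assoc)
qed

lemma t_f: "t * f = f * (k * (k * t))"
proof -
  let ?b = "h1 + h2"
  have "(h2 ^ 2 - h1 ^ 2) * f = f * ((h2 ^ 2 - h1 ^ 2) + (?b + ?b))"
    by (simp add: power2_eq_square algebra_simps h_simps)
  hence "t * f = f * hexp ((h2 ^ 2 - h1 ^ 2) + (?b + ?b))" unfolding t_def by (rule hexp_conj)
  also have "hexp ((h2 ^ 2 - h1 ^ 2) + (?b + ?b)) = t * hexp (?b + ?b)"
    unfolding t_def
    by (rule hexp_add) (simp add: power2_eq_square algebra_simps h_simps)
  also have "hexp (?b + ?b) = k * k" unfolding k_def by (rule hexp_add) simp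
  finally show ?thesis by (simp add: k_t mult.assoc [symmetric]) (simp add: k_t mult.assoc)
qed

end

section \<open>Transport of the relations along linear maps\<close>

lemma halg_hom_hsinh2: "halg_hom L \<Longrightarrow> L (hsinh2 x) = hsinh2 (L x)"
  by (simp add: hsinh2_def hlin_hseries hlin_hscalar hlin_diff hlin_uminus halg_hom_lin
      halg_hom_power div_power_def del: power_Suc fact_Suc)

lemma gl11_rels_hom:
  assumes L: "halg_hom L" and "gl11_rels e f h1 h2"
  shows "gl11_rels (L e) (L f) (L h1) (L h2)"
proof -
  interpret gl11_rels e f h1 h2 by fact
  note simps = halg_hom_mult[OF L, symmetric] hlin_add[OF halg_hom_lin[OF L], symmetric]
    hlin_diff[OF halg_hom_lin[OF L], symmetric] hlin_hscalar[OF halg_hom_lin[OF L], symmetric]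
    halg_hom_hsinh2[OF L, symmetric]
  show ?thesis
    by standard (simp_all only: simps h1_h2 h1_e h2_e h1_f h2_f e_f e_e f_f hlin_0[OF halg_hom_lin[OF L]])
qed

text \<open>The hypotheses speak of powers of h and -h alone because L is also taken to be the
  antipode, which reverses products.\<close>

lemma flin_shift_free_exp:
  assumes "flin L" "\<And>n. L (fps_const (h ^ n)) = y ^ n" "\<And>n. L (fps_const ((- h) ^ n)) = (- y) ^ n"
  shows "L (fps_shift 1 (free_exp h - free_exp (- h))) = hsinh2 y"
proof -
  have *: "L (fps_const (scalar c * s)) = hscalar (fps_const c) * L (fps_const s)" for c s
    using flin_const_scalar[OF assms(1), of c "fps_const s"] by simp
  show ?thesis
    by (subst flin_hseries[OF assms(1)])
      (simp add: hsinh2_def free_exp_def div_power_def fps_const_sub [symmetric] flin_diff[OF assms(1)]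
        * assms(2,3) del: fps_const_sub power_Suc fact_Suc)
qed

lemma relators_word_cases:
  fixes P
  defines "B \<equiv> \<lambda>g. fps_const (basis_vec (Word [g]))"
    and "h \<equiv> basis_vec (Word [gH1]) + basis_vec (Word [gH2])"
  assumes "r \<in> relators"
    and "P (B gH1 * B gH2 - B gH2 * B gH1)"
    and "P (B gH1 * B gE - B gE * B gH1 - B gE)"
    and "P (B gH2 * B gE - B gE * B gH2 + B gE)"
    and "P (B gH1 * B gF - B gF * B gH1 + B gF)"
    and "P (B gH2 * B gF - B gF * B gH2 - B gF)"
    and "P (B gE * B gF + B gF * B gE - scalar_fps (inverse q_diff_div) *
           fps_shift 1 (free_exp h - free_exp (- h)))"
    and "P (B gE * B gE)"
    and "P (B gF * B gF)"
  shows "P r"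
  using assms by (auto simp: relators_word_def gl11_relators_def Let_def free_gen_def q_diff_div_def)

lemma word_hom_relators:
  fixes \<phi> :: "word \<Rightarrow> 'b::presented halg"
  assumes \<phi>: "multiplicative \<phi>"
    and rels: "gl11_rels (\<phi> (Word [gE])) (\<phi> (Word [gF])) (\<phi> (Word [gH1])) (\<phi> (Word [gH2]))"
    and "r \<in> relators"
  shows "fps_ext_lin \<phi> r = 0"
proof -
  interpret gl11_rels "\<phi> (Word [gE])" "\<phi> (Word [gF])" "\<phi> (Word [gH1])" "\<phi> (Word [gH2])" by fact
  let ?L = "fps_ext_lin \<phi>"
  let ?h = "basis_vec (Word [gH1]) + basis_vec (Word [gH2])"
  note lin = flin_fps_ext_lin[of \<phi>]
  note simps = flin_diff[OF lin] flin_add[OF lin] fps_ext_lin_mult[OF \<phi>]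
  have 1: "?L 1 = 1"
    using fps_ext_lin_basis[of \<phi> bone] \<phi> by (simp add: multiplicative_def del: fps_ext_lin_basis)
  hence c: "?L (scalar_fps c) = hscalar c" for c
    using flin_scalar[OF lin, of c 1] by simp
  have pow: "?L (fps_const (s ^ n)) = ?L (fps_const s) ^ n" for s n
    by (induction n) (simp_all add: 1 fps_const_mult [symmetric] fps_ext_lin_mult[OF \<phi>] del: fps_const_mult)
  have h: "?L (fps_const ?h) = \<phi> (Word [gH1]) + \<phi> (Word [gH2])"
    by (simp add: fps_const_add [symmetric] flin_add[OF lin] del: fps_const_add)
  have mh: "?L (fps_const (- ?h)) = - (\<phi> (Word [gH1]) + \<phi> (Word [gH2]))"
    by (simp only: h flin_uminus[OF lin] flip: fps_const_neg)
  have D: "?L (fps_shift 1 (free_exp ?h - free_exp (- ?h))) = hsinh2 (\<phi> (Word [gH1]) + \<phi> (Word [gH2]))"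
    by (rule flin_shift_free_exp[OF lin]) (simp_all only: pow h mh)
  show ?thesis using assms(3)
    by (cases rule: relators_word_cases; simp only: simps fps_ext_lin_basis c D)
      (simp_all add: h1_h2 h1_e h2_e h1_f h2_f e_f e_e f_f)
qed

lemma word_mult: "bmul (Word v) (Word w) = Word (v @ w)" "bsgn v' (w' :: word) = 1"
  by (simp_all add: bmul_word_def bsgn_word_def)

lemma hbasis_word_Cons: "hbasis (Word (g # w)) = hbasis (Word [g]) * hbasis (Word w)"
  by (simp add: hbasis_mult word_mult)

lemma hbasis_word_append: "hbasis (Word (v @ w)) = hbasis (Word v) * hbasis (Word w)"
  by (simp add: hbasis_mult word_mult)

lemma gl11_rels_Uh: "gl11_rels E\<^sub>h F\<^sub>h H1\<^sub>h H2\<^sub>h"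
proof -
  let ?B = "\<lambda>g. fps_const (basis_vec (Word [g]))"
  let ?h = "basis_vec (Word [gH1]) + basis_vec (Word [gH2])"
  note lin = flin_abs_halg[where 'a = word]
  have mult: "abs_halg (f * g) = abs_halg f * abs_halg g" for f g :: "word salg fps"
    by (simp add: times_halg.abs_eq)
  have pow: "abs_halg (fps_const (s ^ n)) = abs_halg (fps_const s) ^ n" for s :: "word salg" and n
    by (induction n) (simp_all add: one_halg.abs_eq fps_const_mult [symmetric] mult del: fps_const_mult)
  have gen: "abs_halg (?B gE) = E\<^sub>h" "abs_halg (?B gF) = F\<^sub>h" "abs_halg (?B gH1) = H1\<^sub>h" "abs_halg (?B gH2) = H2\<^sub>h"
    by (simp_all add: hbasis_def E\<^sub>h_def F\<^sub>h_def H1\<^sub>h_def H2\<^sub>h_def)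
  have h: "abs_halg (fps_const ?h) = H1\<^sub>h + H2\<^sub>h"
    by (simp add: fps_const_add [symmetric] flin_add[OF lin] gen del: fps_const_add)
  have mh: "abs_halg (fps_const (- ?h)) = - (H1\<^sub>h + H2\<^sub>h)"
    by (simp only: h flin_uminus[OF lin] flip: fps_const_neg)
  have D: "abs_halg (fps_shift 1 (free_exp ?h - free_exp (- ?h))) = hsinh2 (H1\<^sub>h + H2\<^sub>h)"
    by (rule flin_shift_free_exp[OF lin]) (simp_all only: pow h mh)
  have "\<forall>r\<in>gl11_relators. abs_halg r = 0"
    by (simp add: abs_halg_eq_0_iff relators_rel_ideal relators_word_def [symmetric])
  hence "H1\<^sub>h * H2\<^sub>h - H2\<^sub>h * H1\<^sub>h = 0 \<and> H1\<^sub>h * E\<^sub>h - E\<^sub>h * H1\<^sub>h - E\<^sub>h = 0 \<and> H2\<^sub>h * E\<^sub>h - E\<^sub>h * H2\<^sub>h + E\<^sub>h = 0 \<and>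
      H1\<^sub>h * F\<^sub>h - F\<^sub>h * H1\<^sub>h + F\<^sub>h = 0 \<and> H2\<^sub>h * F\<^sub>h - F\<^sub>h * H2\<^sub>h - F\<^sub>h = 0 \<and>
      E\<^sub>h * F\<^sub>h + F\<^sub>h * E\<^sub>h - hscalar (inverse q_diff_div) * hsinh2 (H1\<^sub>h + H2\<^sub>h) = 0 \<and>
      E\<^sub>h * E\<^sub>h = 0 \<and> F\<^sub>h * F\<^sub>h = 0"
    unfolding gl11_relators_def Let_def free_gen_def q_diff_div_def [symmetric]
    by (simp only: ball_simps flin_diff[OF lin] flin_add[OF lin] mult gen D simp_thms
        hscalar_def [symmetric])
  thus ?thesis by unfold_locales (simp_all add: algebra_simps eq_diff_eq)
qed

section \<open>Supercommutation of the two tensor factors\<close>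

lemma neg_one_power_left_commute: "x * ((- 1) ^ n * y) = (- 1) ^ n * (x * y :: 'a::presented halg)"
  unfolding neg_one_power by (rule hscalar_left_commute)

lemma neg_one_power_merge: "(- 1) ^ m * ((- 1) ^ n * x) = (- 1) ^ (m + n) * (x :: 'a::presented halg)"
  by (simp add: power_add mult.assoc)

text \<open>Expanding x over an even representative leaves only even monomials, so the exchange sign
  of each is removed by \<open>fps_ext_lin_sign\<close> with p = 0.\<close>

lemma emb2_emb1_even:
  assumes "even_elem x"
  shows "emb2 x * emb1 y = emb1 y * emb2 x"
proof -
  obtain f where f: "x = abs_halg f" "fps_homog 0 f" using assms by (rule even_elemE)
  note lin = halg_hom_lin[OF halg_hom_emb1] halg_hom_lin[OF halg_hom_emb2]
  note lin2 = flin_hlin[OF lin(2) flin_abs_halg]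
  show ?thesis
  proof (rule hlin_eqI[OF hlin_comp[OF hlin_mult_left lin(1)] hlin_comp[OF hlin_mult_right lin(1)]])
    fix a
    have "emb2 (abs_halg f) * emb1 (hbasis a) =
        fps_ext_lin (\<lambda>b. (- 1) ^ (0 + bpar a * bpar b) * (emb1 (hbasis a) * emb2 (hbasis b))) f"
      by (rule flin_eqI[OF flin_hlin[OF hlin_mult_right lin2] flin_fps_ext_lin])
        (simp add: emb2_emb1_hbasis flip: hbasis_def)
    also have "\<dots> = fps_ext_lin (\<lambda>b. emb1 (hbasis a) * emb2 (hbasis b)) f"
      by (subst fps_ext_lin_sign[OF f(2)]) simp
    also have "\<dots> = emb1 (hbasis a) * emb2 (abs_halg f)"
      by (rule flin_eqI[OF flin_fps_ext_lin flin_hlin[OF hlin_mult_left lin2]])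
        (simp flip: hbasis_def)
    finally show "emb2 x * emb1 (hbasis a) = emb1 (hbasis a) * emb2 x" by (simp add: f(1))
  qed
qed

lemma emb1_even_emb2:
  assumes "even_elem x"
  shows "emb2 y * emb1 x = emb1 x * emb2 y"
  using arg_cong[OF emb2_emb1_even[OF assms, of y], of flip]
  by (simp add: halg_hom_mult[OF halg_hom_flip] flip_emb1 flip_emb2)

section \<open>The comultiplication\<close>

interpretation U: gl11_rels E\<^sub>h F\<^sub>h H1\<^sub>h H2\<^sub>h
  rewrites "gl11_rels.k H1\<^sub>h H2\<^sub>h = K\<^sub>h" and "gl11_rels.ki H1\<^sub>h H2\<^sub>h = Kinv\<^sub>h"
proof -
  interpret gl11_rels E\<^sub>h F\<^sub>h H1\<^sub>h H2\<^sub>h by (rule gl11_rels_Uh)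
  show "gl11_rels E\<^sub>h F\<^sub>h H1\<^sub>h H2\<^sub>h" by (rule gl11_rels_Uh)
  show "k = K\<^sub>h" by (simp add: k_def K\<^sub>h_def)
  show "ki = Kinv\<^sub>h" by (simp add: ki_def Kinv\<^sub>h_def)
qed

lemma even_H: "even_elem H1\<^sub>h" "even_elem H2\<^sub>h"
  by (simp_all add: H1\<^sub>h_def H2\<^sub>h_def even_elem_hbasis bpar_word_def)

lemma even_K: "even_elem K\<^sub>h" "even_elem Kinv\<^sub>h"
  unfolding K\<^sub>h_def Kinv\<^sub>h_def by (intro even_elem_hexp even_elem_add even_elem_uminus even_H)+

lemma even_t: "even_elem U.t"
  unfolding U.t_def diff_conv_add_uminus
  by (intro even_elem_hexp even_elem_add even_elem_uminus even_elem_power even_H)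

lemma emb_odd_anticommute:
  "emb2 E\<^sub>h * emb1 E\<^sub>h = - (emb1 E\<^sub>h * emb2 E\<^sub>h)"
  "emb2 E\<^sub>h * emb1 F\<^sub>h = - (emb1 F\<^sub>h * emb2 E\<^sub>h)"
  "emb2 F\<^sub>h * emb1 E\<^sub>h = - (emb1 E\<^sub>h * emb2 F\<^sub>h)"
  "emb2 F\<^sub>h * emb1 F\<^sub>h = - (emb1 F\<^sub>h * emb2 F\<^sub>h)"
  by (simp_all add: E\<^sub>h_def F\<^sub>h_def emb2_emb1_hbasis bpar_word_def)

lemmas emb_odd_left_anticommute = emb_odd_anticommute[THEN left_anticommute_of_anticommute]

lemmas emb_even_commute =
  even_H[THEN emb2_emb1_even] even_K[THEN emb2_emb1_even]
  even_H[THEN emb1_even_emb2] even_K[THEN emb1_even_emb2]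

lemmas emb_even_left_commute = emb_even_commute[THEN left_commute_of_commute]

abbreviation e1 :: UhUh where "e1 \<equiv> emb1 E\<^sub>h"
abbreviation f1 :: UhUh where "f1 \<equiv> emb1 F\<^sub>h"
abbreviation k1 :: UhUh where "k1 \<equiv> emb1 K\<^sub>h"
abbreviation ki1 :: UhUh where "ki1 \<equiv> emb1 Kinv\<^sub>h"
abbreviation e2 :: UhUh where "e2 \<equiv> emb2 E\<^sub>h"
abbreviation f2 :: UhUh where "f2 \<equiv> emb2 F\<^sub>h"
abbreviation k2 :: UhUh where "k2 \<equiv> emb2 K\<^sub>h"
abbreviation ki2 :: UhUh where "ki2 \<equiv> emb2 Kinv\<^sub>h"

interpretation U1: gl11_rels e1 f1 "emb1 H1\<^sub>h :: UhUh" "emb1 H2\<^sub>h"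
  rewrites "gl11_rels.k (emb1 H1\<^sub>h :: UhUh) (emb1 H2\<^sub>h) = k1"
    and "gl11_rels.ki (emb1 H1\<^sub>h :: UhUh) (emb1 H2\<^sub>h) = ki1"
    and "gl11_rels.t (emb1 H1\<^sub>h :: UhUh) (emb1 H2\<^sub>h) = emb1 U.t"
proof -
  interpret gl11_rels e1 f1 "emb1 H1\<^sub>h :: UhUh" "emb1 H2\<^sub>h"
    by (rule gl11_rels_hom[OF halg_hom_emb1 gl11_rels_Uh])
  show "gl11_rels e1 f1 (emb1 H1\<^sub>h :: UhUh) (emb1 H2\<^sub>h)" ..
  note simps = halg_hom_hexp[OF halg_hom_emb1] hlin_add[OF halg_hom_lin[OF halg_hom_emb1]]
    hlin_uminus[OF halg_hom_lin[OF halg_hom_emb1]] hlin_diff[OF halg_hom_lin[OF halg_hom_emb1]]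
    halg_hom_power[OF halg_hom_emb1]
  show "k = k1" "ki = ki1" "t = emb1 U.t"
    by (simp_all only: k_def K\<^sub>h_def ki_def Kinv\<^sub>h_def t_def U.t_def simps)
qed

interpretation U2: gl11_rels e2 f2 "emb2 H1\<^sub>h :: UhUh" "emb2 H2\<^sub>h"
  rewrites "gl11_rels.k (emb2 H1\<^sub>h :: UhUh) (emb2 H2\<^sub>h) = k2"
    and "gl11_rels.ki (emb2 H1\<^sub>h :: UhUh) (emb2 H2\<^sub>h) = ki2"
    and "gl11_rels.t (emb2 H1\<^sub>h :: UhUh) (emb2 H2\<^sub>h) = emb2 U.t"
proof -
  interpret gl11_rels e2 f2 "emb2 H1\<^sub>h :: UhUh" "emb2 H2\<^sub>h"
    by (rule gl11_rels_hom[OF halg_hom_emb2 gl11_rels_Uh])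
  show "gl11_rels e2 f2 (emb2 H1\<^sub>h :: UhUh) (emb2 H2\<^sub>h)" ..
  note simps = halg_hom_hexp[OF halg_hom_emb2] hlin_add[OF halg_hom_lin[OF halg_hom_emb2]]
    hlin_uminus[OF halg_hom_lin[OF halg_hom_emb2]] hlin_diff[OF halg_hom_lin[OF halg_hom_emb2]]
    halg_hom_power[OF halg_hom_emb2]
  show "k = k2" "ki = ki2" "t = emb2 U.t"
    by (simp_all only: k_def K\<^sub>h_def ki_def Kinv\<^sub>h_def t_def U.t_def simps)
qed

lemma comult_gen_eq:
  "comult_gen gE = e1 * ki2 + e2"
  "comult_gen gF = f1 + k1 * f2"
  "comult_gen gH1 = emb1 H1\<^sub>h + emb2 H1\<^sub>h"
  "comult_gen gH2 = emb1 H2\<^sub>h + emb2 H2\<^sub>h"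
  by (simp_all add: tensor_eq halg_hom_1[OF halg_hom_emb1] halg_hom_1[OF halg_hom_emb2])

lemmas emb_simps = emb_odd_anticommute emb_odd_left_anticommute emb_even_commute emb_even_left_commute
lemmas copy_simps = U1.h_simps U2.h_simps U1.k_e U1.k_f U1.k_h U2.k_e U2.k_f U2.k_h
  U1.e_e U1.f_f U2.e_e U2.f_f
lemmas k_left_simps = U1.k_e[THEN left_commute_of_commute] U1.k_f[THEN left_commute_of_commute]
  U1.k_h[THEN left_commute_of_commute] U2.k_e[THEN left_commute_of_commute]
  U2.k_f[THEN left_commute_of_commute] U2.k_h[THEN left_commute_of_commute]

text \<open>In the anticommutator of \<Delta>(E) and \<Delta>(F) the mixed terms cancel by the sign
  rule, leaving (EF + FE) \<otimes> Kinv + K \<otimes> (EF + FE). The asymmetric form of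
  \<open>hsinh2_add\<close> is made to sum exactly these two terms.\<close>

lemma gl11_rels_comult:
  "gl11_rels (comult_gen gE) (comult_gen gF) (comult_gen gH1) (comult_gen gH2)"
  unfolding comult_gen_eq
proof
  have e1_e1: "e1 * (e1 * x) = 0" for x
    by (simp add: U1.e_e flip: mult.assoc)
  let ?x = "emb1 H1\<^sub>h + emb1 H2\<^sub>h :: UhUh" and ?y = "emb2 H1\<^sub>h + emb2 H2\<^sub>h :: UhUh"
  have "(e1 * ki2 + e2) * (f1 + k1 * f2) + (f1 + k1 * f2) * (e1 * ki2 + e2) =
      (e1 * f1 + f1 * e1) * ki2 + k1 * (e2 * f2 + f2 * e2)"
    by (simp add: algebra_simps emb_simps copy_simps k_left_simps)
  also have "\<dots> = hscalar (inverse q_diff_div) * (hsinh2 ?x * ki2 + k1 * hsinh2 ?y)"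
    by (simp only: U1.e_f U2.e_f distrib_left mult.assoc hscalar_left_commute)
  also have "hsinh2 ?x * ki2 + k1 * hsinh2 ?y = hsinh2 (?x + ?y)"
  proof -
    have "?x * ?y = ?y * ?x" by (simp add: algebra_simps emb_simps)
    from hsinh2_add[OF this] show ?thesis by (simp only: U2.ki_def [symmetric] U1.k_def [symmetric])
  qed
  also have "?x + ?y = (emb1 H1\<^sub>h + emb2 H1\<^sub>h) + (emb1 H2\<^sub>h + emb2 H2\<^sub>h)" by (simp add: algebra_simps)
  finally show "(e1 * ki2 + e2) * (f1 + k1 * f2) + (f1 + k1 * f2) * (e1 * ki2 + e2) =
      hscalar (inverse q_diff_div) * hsinh2 (emb1 H1\<^sub>h + emb2 H1\<^sub>h + (emb1 H2\<^sub>h + emb2 H2\<^sub>h))" .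
  show "(e1 * ki2 + e2) * (e1 * ki2 + e2) = 0" "(f1 + k1 * f2) * (f1 + k1 * f2) = 0"
    by (simp_all add: algebra_simps emb_simps copy_simps k_left_simps e1_e1)
qed (simp_all add: algebra_simps emb_simps copy_simps k_left_simps)

lemma multiplicative_comult: "multiplicative (\<lambda>w. prod_list (map comult_gen (letters w)))"
  by (simp add: multiplicative_def bone_word_def bmul_word_def bsgn_word_def)

lemma comult_relators:
  "r \<in> relators \<Longrightarrow> fps_ext_lin (\<lambda>w. prod_list (map comult_gen (letters w))) r = 0"
  using word_hom_relators[OF multiplicative_comult] gl11_rels_comult by simp

lemma halg_hom_comult: "halg_hom comult"
  unfolding comult_def by (intro halg_hom_lin_ext multiplicative_comult comult_relators)

lemma comult_generator: "comult (hbasis (Word [g])) = comult_gen g"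
  unfolding comult_def
  by (subst lin_ext_hbasis)
    (auto intro!: multiplicative_kills_relators multiplicative_comult comult_relators)

section \<open>The antipode\<close>

lemma bpar_word_append: "bpar (Word (v @ w)) = bpar (Word v) + bpar (Word w)"
  by (simp add: bpar_word_def)

lemma antipode_word_append:
  "antipode_word (v @ w) = (- 1) ^ (bpar (Word v) * bpar (Word w)) * (antipode_word w * antipode_word v)"
proof (induction v)
  case (Cons g v)
  have "bpar (Word (g # v)) = gen_par g + bpar (Word v)" by (simp add: bpar_word_def)
  thus ?case
    by (simp add: Cons.IH bpar_word_append mult.assoc neg_one_power_merge
        neg_one_power_left_commute[where x = "antipode_word w"])
      (simp add: algebra_simps)
qed (simp add: bpar_word_def)

text \<open>The antipode and the map defining \<open>u\<^sub>h\<close> carry degree-dependent signs,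
  which come out of a relator because its monomials share one parity.\<close>

lemma fps_homog_relators:
  assumes "r \<in> (relators :: word salg fps set)"
  obtains p where "fps_homog p r"
proof -
  let ?B = "\<lambda>g. fps_const (basis_vec (Word [g]))"
  have g: "fps_homog p (?B g)" if "even (gen_par g + p)" for g p
    by (intro fps_homog_const salg_homog_basis) (use that in \<open>simp add: bpar_word_def\<close>)
  have gg: "fps_homog p (?B g * ?B g')" if "even (gen_par g + gen_par g' + p)" for g g' p
    by (rule fps_homog_parity[OF fps_homog_mult[OF g g] that]) simp_all
  have h: "salg_homog 0 (basis_vec (Word [gH1]) + basis_vec (Word [gH2]))"
    by (intro salg_homog_add salg_homog_basis) (simp_all add: bpar_word_def)
  note D = fps_homog_mult[OF fps_homog_scalar[of "inverse q_diff_div"]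
      fps_homog_shift[OF fps_homog_diff[OF fps_homog_free_exp[OF h]
          fps_homog_free_exp[OF salg_homog_uminus[OF h]]], of 1], unfolded add_0_left]
  have "\<exists>p. fps_homog p r"
    apply (rule relators_word_cases[OF assms])
    subgoal by (rule exI[of _ 0]) (intro fps_homog_diff gg; simp)
    subgoal by (rule exI[of _ 1]) (intro fps_homog_diff fps_homog_add gg g; simp)
    subgoal by (rule exI[of _ 1]) (intro fps_homog_diff fps_homog_add gg g; simp)
    subgoal by (rule exI[of _ 1]) (intro fps_homog_diff fps_homog_add gg g; simp)
    subgoal by (rule exI[of _ 1]) (intro fps_homog_diff fps_homog_add gg g; simp)
    subgoal by (rule exI[of _ 0]) (intro fps_homog_diff fps_homog_add gg D; simp)
    subgoal by (rule exI[of _ 0]) (intro gg; simp)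
    subgoal by (rule exI[of _ 0]) (intro gg; simp)
    done
  thus ?thesis using that by blast
qed

lemma flin_sandwich: "flin L \<Longrightarrow> flin (\<lambda>f. L (g * f * h))"
  using flin_mult_left[OF flin_mult_right] .

lemma fps_ext_lin_sandwich: "fps_ext_lin (\<lambda>a. x * \<psi> a * y) f = x * fps_ext_lin \<psi> f * y"
  by (rule flin_eqI[OF flin_fps_ext_lin flin_hlin[OF hlin_mult_right flin_hlin[OF hlin_mult_left flin_fps_ext_lin]]])
    simp

lemma fps_ext_lin_signed_sandwich:
  assumes "r \<in> (relators :: word salg fps set)" "fps_ext_lin \<psi> r = 0"
  shows "fps_ext_lin (\<lambda>w. (- 1) ^ (m + n * bpar w) * (x * \<psi> w * y)) r = 0"
proof -
  obtain p where "fps_homog p r" using assms(1) by (rule fps_homog_relators)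
  thus ?thesis by (simp add: fps_ext_lin_sign fps_ext_lin_sandwich assms(2))
qed

text \<open>Since products are reversed, \<open>word_hom_relators\<close> does not apply. Quadratic
  terms are evaluated on two-letter words, powers of H1 + H2 by induction: a left factor turns into
  -(H1 + H2) on the right. The relation for EF + FE persists because the anticommutator and
  \<open>hsinh2\<close> both change sign.\<close>

lemma antipode_relators:
  assumes "r \<in> relators"
  shows "fps_ext_lin (\<lambda>w. antipode_word (letters w)) r = 0"
proof -
  let ?A = "\<lambda>w. antipode_word (letters w)"
  let ?L = "fps_ext_lin ?A"
  let ?h = "basis_vec (Word [gH1]) + basis_vec (Word [gH2])"
  note lin = flin_fps_ext_lin[of ?A]
  have B: "?L (fps_const (basis_vec (Word [g])) * fps_const (basis_vec (Word [g']))) = antipode_word [g, g']" for g g'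
    by (simp only: fps_ext_lin_basis_mult word_mult) simp
  have h: "?L (fps_const (?h * s)) = ?L (fps_const s) * - (H1\<^sub>h + H2\<^sub>h)" for s
  proof -
    have "?L (fps_const ?h * f) = ?L f * - (H1\<^sub>h + H2\<^sub>h)" for f
    proof (rule flin_eqI[OF flin_mult_left[OF lin] flin_hlin[OF hlin_mult_right lin]])
      fix w
      show "?L (fps_const ?h * fps_const (basis_vec w)) = ?L (fps_const (basis_vec w)) * - (H1\<^sub>h + H2\<^sub>h)"
        by (cases w) (simp only: fps_const_add [symmetric] distrib_right flin_add[OF lin]
            fps_ext_lin_basis_mult word_mult, simp add: algebra_simps)
    qed
    from this[of "fps_const s"] show ?thesis by simp
  qed
  have mh: "?L (fps_const (- ?h * s)) = ?L (fps_const s) * (H1\<^sub>h + H2\<^sub>h)" for s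
    using h[of s] flin_uminus[OF lin, of "fps_const (?h * s)"]
    by (simp only: mult_minus_left mult_minus_right minus_minus fps_const_neg)
  have 1: "?L 1 = 1"
    using fps_ext_lin_basis[of ?A bone] unfolding basis_vec_bone by (simp add: bone_word_def)
  have D: "?L (fps_shift 1 (free_exp ?h - free_exp (- ?h))) = hsinh2 (- (H1\<^sub>h + H2\<^sub>h))"
  proof (rule flin_shift_free_exp[OF lin])
    show "?L (fps_const (?h ^ n)) = (- (H1\<^sub>h + H2\<^sub>h)) ^ n" for n
      by (induction n) (simp_all only: power_0 power_Suc h 1 fps_const_1_eq_1 power_commutes)
    show "?L (fps_const ((- ?h) ^ n)) = (- (- (H1\<^sub>h + H2\<^sub>h))) ^ n" for n
      by (induction n) (simp_all only: power_0 power_Suc mh 1 fps_const_1_eq_1 power_commutes minus_minus)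
  qed
  note U = U.h_simps U.e_e U.f_f U.k_e U.k_f U.k_h U.k_ki U.k_ki_assoc
    U.k_e[THEN left_commute_of_commute] U.k_f[THEN left_commute_of_commute]
    U.k_h[THEN left_commute_of_commute]
  have EE: "E\<^sub>h * (E\<^sub>h * x) = 0" "F\<^sub>h * (F\<^sub>h * x) = 0" for x
    by (simp_all add: U.e_e U.f_f flip: mult.assoc)
  show ?thesis using assms
    by (cases rule: relators_word_cases;
        simp only: flin_diff[OF lin] flin_add[OF lin] flin_scalar[OF lin] B D fps_ext_lin_basis hsinh2_uminus)
      (simp_all add: bpar_word_def algebra_simps U EE U.e_f [symmetric])
qed

text \<open>Between fixed outer words a and c the antipode acts as w \<mapsto> S(c) S(w) S(a) up to
  sign; reversing three factors gives the exponent |a||c| + (|a| + |c|)|w|, which is affine in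
  |w|.\<close>

lemma kills_relators_antipode: "kills_relators (\<lambda>w. antipode_word (letters w))"
  unfolding kills_relators_def
proof (intro allI ballI)
  fix a c and r :: "word salg fps" assume r: "r \<in> relators"
  let ?A = "\<lambda>w. antipode_word (letters w)"
  have "fps_ext_lin ?A (fps_const (basis_vec a) * r * fps_const (basis_vec c)) =
      fps_ext_lin (\<lambda>w. (- 1) ^ (bpar a * bpar c + (bpar a + bpar c) * bpar w) * (?A c * ?A w * ?A a)) r"
  proof (rule flin_eqI[OF flin_sandwich[OF flin_fps_ext_lin] flin_fps_ext_lin])
    fix w
    obtain a' w' c' where [simp]: "a = Word a'" "w = Word w'" "c = Word c'" by (metis word.exhaust)
    have "fps_const (basis_vec a) * fps_const (basis_vec w) * fps_const (basis_vec c) =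
        fps_const (basis_vec (Word (a' @ w' @ c')))"
      by (simp add: basis_vec_mult word_mult)
    thus "fps_ext_lin ?A (fps_const (basis_vec a) * fps_const (basis_vec w) * fps_const (basis_vec c)) =
        fps_ext_lin (\<lambda>w. (- 1) ^ (bpar a * bpar c + (bpar a + bpar c) * bpar w) * (?A c * ?A w * ?A a))
          (fps_const (basis_vec w))"
      by (simp add: antipode_word_append bpar_word_append mult.assoc neg_one_power_merge)
        (simp add: algebra_simps)
  qed
  also have "\<dots> = 0" by (rule fps_ext_lin_signed_sandwich[OF r antipode_relators[OF r]])
  finally show "fps_ext_lin ?A (fps_const (basis_vec a) * r * fps_const (basis_vec c)) = 0" .
qed

lemma hlin_antipode: "hlin antipode"
  unfolding antipode_def by (rule hlin_lin_ext[OF kills_relators_antipode])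

lemma antipode_hbasis: "antipode (hbasis w) = antipode_word (letters w)"
  unfolding antipode_def by (rule lin_ext_hbasis[OF kills_relators_antipode])

lemma antipode_word_mult_even:
  assumes "gen_par g = 0"
  shows "antipode (y * hbasis (Word [g])) = antipode_gen g * antipode y"
proof (rule hlin_eqI[OF hlin_comp[OF hlin_antipode hlin_mult_right] hlin_comp[OF hlin_mult_left hlin_antipode]])
  fix w
  obtain w' where w: "w = Word w'" by (cases w)
  show "antipode (hbasis w * hbasis (Word [g])) = antipode_gen g * antipode (hbasis w)"
    unfolding w hbasis_word_append [symmetric] antipode_hbasis
    using assms by (simp add: antipode_word_append) (simp add: bpar_word_def)
qed

lemma antipode_mult_H: "antipode (y * H1\<^sub>h) = - (H1\<^sub>h * antipode y)" "antipode (y * H2\<^sub>h) = - (H2\<^sub>h * antipode y)"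
  using antipode_word_mult_even[of gH1 y] antipode_word_mult_even[of gH2 y]
  by (simp_all add: H1\<^sub>h_def H2\<^sub>h_def)

text \<open>The rule passes from x to its powers, where the arbitrary y absorbs the factors already
  treated, and then by continuity to the exponential.\<close>

lemma antipode_mult_hexp:
  assumes "\<And>y. antipode (y * x) = x' * antipode y"
  shows "antipode (y * hexp x) = hexp x' * antipode y"
proof -
  have "antipode (y * x ^ n) = x' ^ n * antipode y" for n
  proof (induction n)
    case (Suc n)
    have "antipode (y * x ^ Suc n) = antipode (y * x ^ n * x)"
      by (simp only: power_Suc2 mult.assoc)
    also have "\<dots> = x' ^ Suc n * antipode y"
      unfolding assms by (simp add: Suc.IH mult.assoc)
    finally show ?case .
  qed simp
  thus ?thesis
    by (simp add: hexp_def hseries_mult_left hseries_mult_right hlin_hseries[OF hlin_antipode]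
        hscalar_left_commute hlin_hscalar[OF hlin_antipode] mult.assoc)
qed

lemmas antipode_lin = hlin_add[OF hlin_antipode] hlin_diff[OF hlin_antipode] hlin_uminus[OF hlin_antipode]

lemma antipode_mult_K: "antipode (y * K\<^sub>h) = Kinv\<^sub>h * antipode y" "antipode (y * Kinv\<^sub>h) = K\<^sub>h * antipode y"
proof -
  have "antipode (y * (H1\<^sub>h + H2\<^sub>h)) = - (H1\<^sub>h + H2\<^sub>h) * antipode y" for y
    by (simp add: antipode_mult_H antipode_lin algebra_simps)
  from antipode_mult_hexp[OF this] show "antipode (y * K\<^sub>h) = Kinv\<^sub>h * antipode y"
    by (simp only: K\<^sub>h_def Kinv\<^sub>h_def)
  have "antipode (y * - (H1\<^sub>h + H2\<^sub>h)) = (H1\<^sub>h + H2\<^sub>h) * antipode y" for y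
    by (simp add: antipode_mult_H antipode_lin algebra_simps)
  from antipode_mult_hexp[OF this] show "antipode (y * Kinv\<^sub>h) = K\<^sub>h * antipode y"
    by (simp only: K\<^sub>h_def Kinv\<^sub>h_def)
qed

lemma antipode_mult_t: "antipode (y * U.t) = U.t * antipode y"
  unfolding U.t_def power2_eq_square
  by (rule antipode_mult_hexp)
    (simp add: antipode_mult_H antipode_lin right_diff_distrib left_diff_distrib mult.assoc [symmetric])

lemma antipode_1: "antipode 1 = 1"
  using antipode_hbasis[of bone] by (simp add: bone_word_def [symmetric]) (simp add: bone_word_def)

lemma antipode_E_F: "antipode (E\<^sub>h * F\<^sub>h) = - (F\<^sub>h * E\<^sub>h)"
proof -
  have "antipode (E\<^sub>h * F\<^sub>h) = - (Kinv\<^sub>h * F\<^sub>h * (E\<^sub>h * K\<^sub>h))"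
    unfolding E\<^sub>h_def F\<^sub>h_def hbasis_word_append [symmetric] antipode_hbasis
    by (simp add: bpar_word_def E\<^sub>h_def F\<^sub>h_def)
  thus ?thesis
    by (simp add: mult.assoc U.k_e [symmetric] U.k_f(1)[THEN left_commute_of_commute, symmetric] U.k_ki_assoc)
qed

section \<open>The counit\<close>

definition salg_counit :: "word salg \<Rightarrow> complex" where
  "salg_counit s = Poly_Mapping.lookup (vec s) (Word [])"

lemma salg_counit_add: "salg_counit (s + t) = salg_counit s + salg_counit t"
  by (simp add: salg_counit_def plus_salg.rep_eq lookup_add)

lemma salg_counit_0 [simp]: "salg_counit 0 = 0"
  by (simp add: salg_counit_def zero_salg.rep_eq)

lemma salg_counit_uminus: "salg_counit (- s) = - salg_counit s"
  by (simp add: salg_counit_def uminus_salg.rep_eq)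

lemma salg_counit_diff: "salg_counit (s - t) = salg_counit s - salg_counit t"
  by (simp add: salg_counit_def minus_salg.rep_eq lookup_minus)

lemma salg_counit_sum: "salg_counit (sum f A) = (\<Sum>i\<in>A. salg_counit (f i))"
  by (induction A rule: infinite_finite_induct) (simp_all add: salg_counit_add)

lemma salg_counit_scalar: "salg_counit (scalar c) = c"
  by (simp add: salg_counit_def scalar_def of_vec_inverse bone_word_def)

lemma salg_counit_scalar_mult: "salg_counit (scalar c * s) = c * salg_counit s"
  by (simp add: salg_counit_def lookup_scalar_mult)

lemma salg_counit_basis: "salg_counit (basis_vec w) = (if w = Word [] then 1 else 0)"
  by (simp add: salg_counit_def basis_vec_def of_vec_inverse lookup_single when_def)

lemma salg_counit_mult: "salg_counit (s * t) = salg_counit s * salg_counit t"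
proof (induction s rule: salg_induct)
  case (basis c a)
  show ?case
  proof (induction t rule: salg_induct)
    case (basis d b)
    have "basis_vec a * (scalar d * basis_vec b) = scalar d * (basis_vec a * basis_vec b)"
      by (simp only: mult.assoc [symmetric] scalar_commute[of d "basis_vec a"])
    hence "scalar c * basis_vec a * (scalar d * basis_vec b) = scalar c * (scalar d * basis_vec (bmul a b))"
      by (simp add: mult.assoc basis_vec_mult bsgn_word_def)
    thus ?case
      by (cases a; cases b) (auto simp: salg_counit_scalar_mult salg_counit_basis bmul_word_def)
  qed (simp_all add: salg_counit_add distrib_left)
qed (simp_all add: salg_counit_add distrib_right)

lemma salg_counit_power: "salg_counit s = 0 \<Longrightarrow> salg_counit (s ^ Suc n) = 0"
  by (simp add: salg_counit_mult)

definition fps_counit :: "word salg fps \<Rightarrow> complex fps" where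
  "fps_counit f = Abs_fps (\<lambda>n. salg_counit (fps_nth f n))"

lemma fps_counit_add: "fps_counit (f + g) = fps_counit f + fps_counit g"
  by (simp add: fps_counit_def fps_eq_iff salg_counit_add)

lemma fps_counit_diff: "fps_counit (f - g) = fps_counit f - fps_counit g"
  by (simp add: fps_counit_def fps_eq_iff salg_counit_diff)

lemma fps_counit_mult: "fps_counit (f * g) = fps_counit f * fps_counit g"
  by (simp add: fps_counit_def fps_eq_iff fps_mult_nth salg_counit_sum salg_counit_mult)

lemma fps_counit_relators:
  assumes "r \<in> relators"
  shows "fps_counit r = 0"
proof -
  have g: "fps_counit (fps_const (basis_vec (Word [g]))) = 0" for g
    by (simp add: fps_counit_def fps_eq_iff salg_counit_basis)
  let ?h = "basis_vec (Word [gH1]) + basis_vec (Word [gH2])"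
  have "salg_counit ?h = 0" "salg_counit (- ?h) = 0"
    by (simp_all only: salg_counit_add salg_counit_uminus salg_counit_basis) simp_all
  hence D: "fps_counit (fps_shift 1 (free_exp ?h - free_exp (- ?h))) = 0"
    by (simp add: fps_counit_def fps_eq_iff free_exp_def salg_counit_diff salg_counit_scalar_mult
        salg_counit_power del: power_Suc)
  show ?thesis
    by (rule relators_word_cases[OF assms];
        simp only: fps_counit_add fps_counit_diff fps_counit_mult g D; simp)
qed

text \<open>The kernel of the counit is a closed two-sided ideal containing the relators. As the
  target is \<complex>[[\<hbar>]], closedness is read off from coefficients.\<close>

lemma fps_counit_rel_ideal:
  assumes "f \<in> rel_ideal"
  shows "fps_counit f = 0"
proof -
  define N where "N = {f. fps_counit f = 0}"
  have "two_sided_ideal N"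
    unfolding two_sided_ideal_def N_def
    by (simp add: fps_counit_add fps_counit_mult) (simp add: fps_counit_def fps_eq_iff)
  moreover have "closed N"
  proof (rule closed_fpsI)
    fix f assume f: "\<And>k. \<exists>g. f - fps_X ^ k * g \<in> N"
    have "fps_nth (fps_counit f) n = 0" for n
    proof -
      \<comment> \<open>Approximation to order n + 1 determines the coefficient of degree n.\<close>
      obtain g where "fps_counit f = fps_counit (fps_X ^ Suc n * g)"
        using f[of "Suc n"] by (auto simp: N_def fps_counit_diff)
      also have "fps_nth \<dots> n = 0"
        by (simp only: fps_counit_def fps_nth_Abs_fps fps_X_power_mult_nth) simp
      finally show ?thesis .
    qed
    thus "f \<in> N" by (simp add: N_def fps_eq_iff)
  qed
  moreover have "relators \<subseteq> N" by (auto simp: N_def fps_counit_relators)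
  ultimately have "rel_ideal \<subseteq> N" unfolding rel_ideal_def by blast
  with assms show ?thesis by (auto simp: N_def)
qed

lemma counit_eq: "counit x = fps_counit (rep_halg x)"
  by (simp add: counit_def fps_counit_def salg_counit_def)

lemma counit_abs_halg: "counit (abs_halg f) = fps_counit f"
proof -
  have "rep_halg (abs_halg f) - f \<in> rel_ideal"
    using Quotient_rep_abs[OF Quotient_halg, of f] by (simp add: rel_ideal_zero)
  from fps_counit_rel_ideal[OF this] show ?thesis by (simp add: counit_eq fps_counit_diff)
qed

lemma counit_add: "counit (x + y) = counit x + counit y"
  by (induction x rule: halg.abs_induct, induction y rule: halg.abs_induct)
    (simp add: plus_halg.abs_eq counit_abs_halg fps_counit_add)

lemma counit_mult: "counit (x * y) = counit x * counit y"
  by (induction x rule: halg.abs_induct, induction y rule: halg.abs_induct)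
    (simp add: times_halg.abs_eq counit_abs_halg fps_counit_mult)

lemma counit_hscalar: "counit (hscalar c) = c"
  by (simp add: hscalar_def counit_abs_halg fps_counit_def fps_eq_iff salg_counit_scalar)

lemma counit_uminus: "counit (- x) = - counit x"
  using counit_mult[of "hscalar (- 1)" x] by (simp add: counit_hscalar) (simp add: hscalar_uminus)

lemma counit_power: "counit (x ^ n) = counit x ^ n"
  using counit_hscalar[of 1] by (induction n) (simp_all add: counit_mult)

lemma counit_generator: "counit (hbasis (Word [g])) = 0"
  by (simp add: hbasis_def counit_abs_halg fps_counit_def fps_eq_iff salg_counit_basis)

lemma counit_hexp:
  assumes "counit x = 0"
  shows "counit (hexp x) = 1"
proof -
  have "fps_nth (counit (hseries y)) m = (\<Sum>n\<le>m. fps_nth (counit (y n)) (m - n))" for y m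
    unfolding hseries_def counit_abs_halg by (simp add: counit_eq fps_counit_def salg_counit_sum)
  moreover have "counit (div_power x n) = (if n = 0 then 1 else 0)" for n
    using assms by (cases n) (simp_all add: div_power_def counit_mult counit_hscalar counit_power
        counit_hscalar[of 1, simplified])
  ultimately have "fps_nth (counit (hexp x)) m = (\<Sum>n\<le>m. if n = 0 then fps_nth 1 m else 0)" for m
    unfolding hexp_eq by (simp add: if_distrib[of "\<lambda>f. fps_nth f _"] cong: if_cong)
  thus ?thesis by (simp add: fps_eq_iff sum.delta)
qed

section \<open>The Drinfeld element\<close>

abbreviation u_map :: "word \<times> word \<Rightarrow> Uh" where
  "u_map \<equiv> \<lambda>(a, b). (- 1) ^ (bpar a * bpar b) * (antipode (hbasis b) * hbasis a)"

lemma fps_ext_lin_scalar_basis: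
  "fps_ext_lin \<phi> (fps_const (scalar c * basis_vec a)) = hscalar (fps_const c) * \<phi> a"
  using flin_const_scalar[OF flin_fps_ext_lin, of \<phi> c "fps_const (basis_vec a)"] by simp

text \<open>A monomial w of a relator in the first factor ends up in S(bd) a w c, one in the second
  factor in S(d) S(w) S(b) ac. Either way the sign is affine in |w|; the repeated summands in the
  exponents come from the tensor product, the sign in \<open>u_map\<close> and, in the second case,
  the antipode.\<close>

lemma kills_relators_u: "kills_relators u_map"
  unfolding kills_relators_def
proof (intro allI ballI)
  fix x y and r :: "(word \<times> word) salg fps" assume "r \<in> relators"
  obtain a b c d where [simp]: "x = (Word a, Word b)" "y = (Word c, Word d)"
    by (metis word.exhaust surj_pair)
  let ?p = "\<lambda>w. bpar (Word w)"
  from \<open>r \<in> relators\<close> consider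
      s where "s \<in> relators" "r = map_basis_fps (\<lambda>a. (a, bone)) s"
    | s where "s \<in> relators" "r = map_basis_fps (\<lambda>b. (bone, b)) s"
    unfolding relators_prod_def by blast
  thus "fps_ext_lin u_map (fps_const (basis_vec x) * r * fps_const (basis_vec y)) = 0"
  proof cases
    case 1
    have "fps_ext_lin u_map (fps_const (basis_vec x) * map_basis_fps (\<lambda>a. (a, bone)) s * fps_const (basis_vec y)) =
      fps_ext_lin (\<lambda>w. (- 1) ^ (?p b * ?p c + (?p a + ?p c) * (?p b + ?p d) + (?p b + (?p b + ?p d)) * bpar w) *
        ((antipode (hbasis (Word (b @ d))) * hbasis (Word a)) * hbasis w * hbasis (Word c))) s"
    proof (rule flin_eqI[OF flin_map_basis_fps[OF flin_sandwich[OF flin_fps_ext_lin]] flin_fps_ext_lin])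
      fix w
      obtain w' where [simp]: "w = Word w'" by (cases w)
      have "fps_const (basis_vec x) * fps_const (basis_vec (w, bone)) * fps_const (basis_vec y) =
          fps_const (scalar ((- 1) ^ (?p b * ?p w' + ?p b * ?p c)) * basis_vec (Word (a @ w' @ c), Word (b @ d)))"
        by (simp add: basis_vec_mult bsgn_prod_def bmul_prod_def bsgn_word_def word_mult power_add
            scalar_mult mult.assoc)
      thus "fps_ext_lin u_map (fps_const (basis_vec x) *
            map_basis_fps (\<lambda>a. (a, bone)) (fps_const (basis_vec w)) * fps_const (basis_vec y)) =
          fps_ext_lin (\<lambda>w. (- 1) ^ (?p b * ?p c + (?p a + ?p c) * (?p b + ?p d) + (?p b + (?p b + ?p d)) * bpar w) *
            ((antipode (hbasis (Word (b @ d))) * hbasis (Word a)) * hbasis w * hbasis (Word c)))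
            (fps_const (basis_vec w))"
        by (simp add: fps_ext_lin_scalar_basis neg_one_power [symmetric] neg_one_power_merge bpar_word_append
            hbasis_word_append mult.assoc)
          (simp add: algebra_simps)
    qed
    also have "\<dots> = 0" by (rule fps_ext_lin_signed_sandwich) (use 1 in simp_all)
    finally show ?thesis by (simp add: 1)
  next
    case 2
    let ?A = "\<lambda>w. antipode_word (letters w)"
    have "fps_ext_lin u_map (fps_const (basis_vec x) * map_basis_fps (\<lambda>a. (bone, a)) s * fps_const (basis_vec y)) =
      fps_ext_lin (\<lambda>w. (- 1) ^ (?p b * ?p c + (?p a + ?p c) * (?p b + ?p d) + ?p b * ?p d +
          (?p c + (?p a + ?p c) + (?p b + ?p d)) * bpar w) *
        (?A (Word d) * ?A w * (?A (Word b) * hbasis (Word (a @ c))))) s"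
    proof (rule flin_eqI[OF flin_map_basis_fps[OF flin_sandwich[OF flin_fps_ext_lin]] flin_fps_ext_lin])
      fix w
      obtain w' where [simp]: "w = Word w'" by (cases w)
      have "fps_const (basis_vec x) * fps_const (basis_vec (bone, w)) * fps_const (basis_vec y) =
          fps_const (scalar ((- 1) ^ ((?p b + ?p w') * ?p c)) * basis_vec (Word (a @ c), Word (b @ w' @ d)))"
        by (simp add: basis_vec_mult bsgn_prod_def bmul_prod_def bsgn_word_def word_mult bpar_word_append)
      thus "fps_ext_lin u_map (fps_const (basis_vec x) *
            map_basis_fps (\<lambda>a. (bone, a)) (fps_const (basis_vec w)) * fps_const (basis_vec y)) =
          fps_ext_lin (\<lambda>w. (- 1) ^ (?p b * ?p c + (?p a + ?p c) * (?p b + ?p d) + ?p b * ?p d +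
              (?p c + (?p a + ?p c) + (?p b + ?p d)) * bpar w) *
            (?A (Word d) * ?A w * (?A (Word b) * hbasis (Word (a @ c)))))
            (fps_const (basis_vec w))"
        by (simp add: fps_ext_lin_scalar_basis neg_one_power [symmetric] neg_one_power_merge bpar_word_append
            antipode_hbasis antipode_word_append mult.assoc)
          (simp add: algebra_simps)
    qed
    also have "\<dots> = 0" by (rule fps_ext_lin_signed_sandwich) (use 2 antipode_relators in simp_all)
    finally show ?thesis by (simp add: 2)
  qed
qed

text \<open>Right multiplication of X by H \<otimes> H turns \<Phi>(X) into -H \<Phi>(X) H, as S(H)
  = -H. For X = \<Theta> the value y has weight zero, so the outer H's merge and each power of the
  exponent of \<Upsilon> becomes the same power of the exponent of \<open>U.t\<close>.\<close>

lemma u_eq: "u\<^sub>h = (1 + hscalar q_diff * (E\<^sub>h * (K\<^sub>h * F\<^sub>h))) * U.t"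
proof -
  define \<Phi> where "\<Phi> = lin_ext u_map"
  have lin: "hlin \<Phi>" unfolding \<Phi>_def by (rule hlin_lin_ext[OF kills_relators_u])
  have \<Phi>: "\<Phi> (hbasis x) = u_map x" for x unfolding \<Phi>_def by (rule lin_ext_hbasis[OF kills_relators_u])
  have \<Phi>_H: "\<Phi> (X * (hbasis (Word [g]) \<otimes>\<^sub>h hbasis (Word [g]))) = antipode_gen g * \<Phi> X * hbasis (Word [g])"
    if "gen_par g = 0" for X g
  proof (rule hlin_eqI[OF hlin_comp[OF lin hlin_mult_right]
        hlin_comp[OF hlin_mult_right hlin_comp[OF hlin_mult_left lin]]])
    fix x :: "word \<times> word"
    obtain a b where x: "x = (Word a, Word b)" by (metis word.exhaust surj_pair)
    have p: "bpar (Word [g]) = 0" using that by (simp add: bpar_word_def)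
    have "hbasis x * (hbasis (Word [g]) \<otimes>\<^sub>h hbasis (Word [g])) = hbasis (Word (a @ [g]), Word (b @ [g]))"
      by (simp add: x tensor_eq emb1_emb2_hbasis hbasis_mult bsgn_prod_def bmul_prod_def bsgn_word_def
          word_mult p)
    thus "\<Phi> (hbasis x * (hbasis (Word [g]) \<otimes>\<^sub>h hbasis (Word [g]))) = antipode_gen g * \<Phi> (hbasis x) * hbasis (Word [g])"
      by (simp add: x \<Phi> bpar_word_append p hbasis_word_append antipode_hbasis antipode_word_append mult.assoc)
        (simp add: bpar_word_def neg_one_power_left_commute)
  qed
  let ?w = "H1\<^sub>h \<otimes>\<^sub>h H1\<^sub>h - H2\<^sub>h \<otimes>\<^sub>h H2\<^sub>h" and ?s = "H2\<^sub>h ^ 2 - H1\<^sub>h ^ 2"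
  define y where "y = 1 + hscalar q_diff * (E\<^sub>h * (K\<^sub>h * F\<^sub>h))"
  have \<Phi>_w: "\<Phi> (X * ?w) = H2\<^sub>h * \<Phi> X * H2\<^sub>h - H1\<^sub>h * \<Phi> X * H1\<^sub>h" for X
    using \<Phi>_H[of gH1 X] \<Phi>_H[of gH2 X] by (simp add: H1\<^sub>h_def H2\<^sub>h_def right_diff_distrib hlin_diff[OF lin])
  have "\<Phi> Theta = y"
  proof -
    have "hbasis (bone, bone) = (1 :: UhUh)"
      using hbasis_bone[where 'a = "word \<times> word"] by (simp only: bone_prod_def)
    hence "\<Phi> 1 = 1" using \<Phi>[of "(bone, bone)"] antipode_1 by simp
    \<comment> \<open>The sign of the odd pair F, E cancels the one in S(E) = -EK.\<close>
    moreover have "\<Phi> (F\<^sub>h \<otimes>\<^sub>h E\<^sub>h) = E\<^sub>h * (K\<^sub>h * F\<^sub>h)"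
      by (simp add: F\<^sub>h_def E\<^sub>h_def tensor_eq emb1_emb2_hbasis \<Phi> bpar_word_def antipode_hbasis mult.assoc)
    ultimately show ?thesis by (simp add: Theta_def y_def hlin_add[OF lin] hlin_hscalar[OF lin])
  qed
  moreover have yH: "H1\<^sub>h * y = y * H1\<^sub>h" "H2\<^sub>h * y = y * H2\<^sub>h"
    unfolding y_def
    by (simp_all add: algebra_simps hscalar_left_commute[of "H1\<^sub>h"] hscalar_left_commute[of "H2\<^sub>h"] U.h_simps
        U.k_h[THEN left_commute_of_commute, symmetric] U.k_h [symmetric])
  have sH: "?s ^ n * H1\<^sub>h = H1\<^sub>h * ?s ^ n" "?s ^ n * H2\<^sub>h = H2\<^sub>h * ?s ^ n" for n
    by (rule power_commuting_commutes; simp add: power2_eq_square algebra_simps U.h_simps)+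
  have "\<Phi> (Theta * ?w ^ n) = y * ?s ^ n" for n
  proof (induction n)
    case (Suc n)
    have yS: "H1\<^sub>h * (y * ?s ^ n) = y * ?s ^ n * H1\<^sub>h" "H2\<^sub>h * (y * ?s ^ n) = y * ?s ^ n * H2\<^sub>h"
      by (metis mult.assoc yH(1) sH(1), metis mult.assoc yH(2) sH(2))
    have "\<Phi> (Theta * ?w ^ Suc n) = H2\<^sub>h * (y * ?s ^ n) * H2\<^sub>h - H1\<^sub>h * (y * ?s ^ n) * H1\<^sub>h"
      by (simp only: power_Suc2 mult.assoc [symmetric] \<Phi>_w Suc.IH)
    also have "\<dots> = y * ?s ^ n * ?s"
      unfolding yS by (simp only: right_diff_distrib power2_eq_square mult.assoc)
    finally show ?case by (simp only: power_Suc2 mult.assoc)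
  qed (simp add: \<open>\<Phi> Theta = y\<close>)
  hence "\<Phi> R\<^sub>h = y * U.t"
    by (simp add: R\<^sub>h_def Upsilon_def U.t_def hexp_def hseries_mult_left hlin_hseries[OF lin]
        hscalar_left_commute[of Theta] hscalar_left_commute[of y] hlin_hscalar[OF lin])
  thus ?thesis by (simp add: u\<^sub>h_def \<Phi>_def y_def)
qed

section \<open>The ribbon element\<close>

lemma halg_hom_hscalar: "halg_hom L \<Longrightarrow> L (hscalar c) = hscalar c"
  using hlin_hscalar[of L c 1] by (simp add: halg_hom_def)

lemma hscalar_square_zero: "n * n = 0 \<Longrightarrow> hscalar c * n * (hscalar c * n) = 0"
  by (simp only: mult.assoc hscalar_left_commute[of n]) simp

text \<open>Commutation passes from generators to words and by density to all x. Against E, the term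
  with E F E contributes E (K - Kinv), which compensates the two factors Kinv that
  \<open>U.t\<close> picks up on its way past E; the case of F is similar.\<close>

lemma v_central:
  assumes v: "v = (Kinv\<^sub>h + hscalar q_diff * E\<^sub>h * F\<^sub>h) * U.t"
  shows "v * x = x * v"
proof -
  let ?z = "hscalar q_diff :: Uh"
  have z: "E\<^sub>h * (?z * x) = ?z * (E\<^sub>h * x)" "F\<^sub>h * (?z * x) = ?z * (F\<^sub>h * x)"
    "H1\<^sub>h * (?z * x) = ?z * (H1\<^sub>h * x)" "H2\<^sub>h * (?z * x) = ?z * (H2\<^sub>h * x)" for x
    by (rule hscalar_left_commute)+
  have EE: "E\<^sub>h * (E\<^sub>h * x) = 0" "F\<^sub>h * (F\<^sub>h * x) = 0" for x
    by (simp_all add: U.e_e U.f_f flip: mult.assoc)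
  have FE: "?z * (F\<^sub>h * (E\<^sub>h * x)) = K\<^sub>h * x - Kinv\<^sub>h * x - ?z * (E\<^sub>h * (F\<^sub>h * x))" for x
    using arg_cong[OF U.q_diff_e_f, of "\<lambda>y. y * x"] by (simp add: algebra_simps)
  \<comment> \<open>In normal form E stands between z and FE, where the rule \<open>FE\<close> does
    not match; multiplying that rule by E fills the gap.\<close>
  have EFE: "?z * (E\<^sub>h * (F\<^sub>h * (E\<^sub>h * x))) = E\<^sub>h * (K\<^sub>h * x) - E\<^sub>h * (Kinv\<^sub>h * x)" for x
    using arg_cong[OF FE[of x], of "\<lambda>y. E\<^sub>h * y"] by (simp add: right_diff_distrib z EE)
  note k = U.k_e U.k_f U.k_h U.k_e[THEN left_commute_of_commute] U.k_f[THEN left_commute_of_commute]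
    U.k_h[THEN left_commute_of_commute] U.k_ki U.k_ki_assoc
  have t: "U.t * E\<^sub>h = E\<^sub>h * (Kinv\<^sub>h * (Kinv\<^sub>h * U.t))" "U.t * F\<^sub>h = F\<^sub>h * (K\<^sub>h * (K\<^sub>h * U.t))"
    by (rule U.t_e U.t_f)+
  have gens: "v * E\<^sub>h = E\<^sub>h * v" "v * F\<^sub>h = F\<^sub>h * v" "v * H1\<^sub>h = H1\<^sub>h * v" "v * H2\<^sub>h = H2\<^sub>h * v"
    unfolding v by (simp_all add: algebra_simps t U.t_h z k EE FE EFE U.h_simps)
  have gen: "v * hbasis (Word [g]) = hbasis (Word [g]) * v" for g
    using gens by (cases g) (simp_all add: E\<^sub>h_def F\<^sub>h_def H1\<^sub>h_def H2\<^sub>h_def)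
  have word: "v * hbasis (Word w) = hbasis (Word w) * v" for w
  proof (induction w)
    case Nil
    show ?case using hbasis_bone[where 'a = word] by (simp add: bone_word_def del: hbasis_bone)
  next
    case (Cons g w)
    have "v * hbasis (Word (g # w)) = hbasis (Word [g]) * (v * hbasis (Word w))"
      unfolding hbasis_word_Cons[of g w] by (simp only: mult.assoc [symmetric] gen)
    thus ?case unfolding hbasis_word_Cons[of g w] by (simp only: Cons.IH mult.assoc)
  qed
  show ?thesis
    by (rule hlin_eqI[OF hlin_mult_left hlin_mult_right]) (metis word word.exhaust)
qed

section \<open>The double braiding \<open>R21\<^sub>h * R\<^sub>h\<close>\<close>

abbreviation (input) hsum1 :: UhUh where "hsum1 \<equiv> emb1 H1\<^sub>h + emb1 H2\<^sub>h"
abbreviation (input) hsum2 :: UhUh where "hsum2 \<equiv> emb2 H1\<^sub>h + emb2 H2\<^sub>h"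
abbreviation (input) logUpsilon :: UhUh where "logUpsilon \<equiv> emb1 H1\<^sub>h * emb2 H1\<^sub>h - emb1 H2\<^sub>h * emb2 H2\<^sub>h"

lemma Upsilon_eq: "Upsilon = hexp logUpsilon"
  by (simp add: Upsilon_def tensor_eq)

lemma hexp_hsum: "hexp (hsum1 + - hsum2) = k1 * ki2" "hexp (- hsum1 + hsum2) = ki1 * k2"
  by (subst hexp_add, simp add: algebra_simps emb_simps, simp only: U1.k_def U2.k_def U1.ki_def U2.ki_def)+

text \<open>F \<otimes> E has opposite weights in its two legs. Moving H1 \<otimes> H1 - H2
  \<otimes> H2 past it adds (H1 + H2) \<otimes> 1 - 1 \<otimes> (H1 + H2), the constants cancelling
  between the two products, and this exponentiates to K \<otimes> Kinv. For E \<otimes> F the shift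
  is the negative.\<close>

lemma Upsilon_conj:
  "Upsilon * (f1 * e2) = f1 * e2 * (k1 * ki2) * Upsilon"
  "Upsilon * (e1 * f2) = e1 * f2 * (ki1 * k2) * Upsilon"
proof -
  have "logUpsilon * (f1 * e2) = f1 * e2 * ((hsum1 + - hsum2) + logUpsilon)"
    by (simp add: algebra_simps emb_simps copy_simps)
  moreover have "(hsum1 + - hsum2) * logUpsilon = logUpsilon * (hsum1 + - hsum2)"
    by (simp add: algebra_simps emb_simps copy_simps)
  ultimately show "Upsilon * (f1 * e2) = f1 * e2 * (k1 * ki2) * Upsilon"
    by (simp only: Upsilon_eq hexp_conj hexp_add hexp_hsum mult.assoc)
next
  have "logUpsilon * (e1 * f2) = e1 * f2 * ((- hsum1 + hsum2) + logUpsilon)"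
    by (simp add: algebra_simps emb_simps copy_simps)
  moreover have "(- hsum1 + hsum2) * logUpsilon = logUpsilon * (- hsum1 + hsum2)"
    by (simp add: algebra_simps emb_simps copy_simps)
  ultimately show "Upsilon * (e1 * f2) = e1 * f2 * (ki1 * k2) * Upsilon"
    by (simp only: Upsilon_eq hexp_conj hexp_add hexp_hsum mult.assoc)
qed

lemma Upsilon_commute: "logUpsilon * y = y * logUpsilon \<Longrightarrow> Upsilon * y = y * Upsilon"
  unfolding Upsilon_eq by (rule hexp_commute)

text \<open>The minus sign is that of flipping F \<otimes> E, whose legs are both odd; \<Upsilon> is
  symmetric with even legs.\<close>

lemma R21_eq: "R21\<^sub>h = (1 - hscalar q_diff * (e1 * f2)) * Upsilon"
proof -
  note hom = halg_hom_flip[where 'a = word and 'b = word]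
  note lin = halg_hom_lin[OF hom]
  have "flip Theta = 1 - hscalar q_diff * (e1 * f2)"
    by (simp add: Theta_def tensor_eq hlin_add[OF lin] hlin_hscalar[OF lin] halg_hom_mult[OF hom]
        halg_hom_1[OF hom] halg_hom_hscalar[OF hom] flip_emb1 flip_emb2 emb_simps)
  moreover have "flip Upsilon = Upsilon"
    by (simp add: Upsilon_eq halg_hom_hexp[OF hom] hlin_diff[OF lin] halg_hom_mult[OF hom]
        flip_emb1 flip_emb2 emb_simps)
  ultimately show ?thesis by (simp add: R21\<^sub>h_def R\<^sub>h_def halg_hom_mult[OF hom])
qed

lemma R_eq: "R\<^sub>h = (1 + hscalar q_diff * (f1 * e2)) * Upsilon"
  by (simp add: R\<^sub>h_def Theta_def tensor_eq)

lemma R21_R_eq: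
  "R21\<^sub>h * R\<^sub>h = (1 - hscalar q_diff * (e1 * f2)) *
     ((1 + hscalar q_diff * (f1 * e2 * (k1 * ki2))) * (Upsilon * Upsilon))"
proof -
  have "Upsilon * (1 + hscalar q_diff * (f1 * e2)) =
      (1 + hscalar q_diff * (f1 * e2 * (k1 * ki2))) * Upsilon"
    by (simp only: distrib_left distrib_right hscalar_left_commute[of Upsilon] Upsilon_conj mult_1_left mult_1_right mult.assoc)
  moreover have "R21\<^sub>h * R\<^sub>h = (1 - hscalar q_diff * (e1 * f2)) *
      (Upsilon * (1 + hscalar q_diff * (f1 * e2)) * Upsilon)"
    by (simp only: R21_eq R_eq mult.assoc)
  ultimately show ?thesis by (simp only: mult.assoc)
qed

lemma left_cancel_inverse: "x * y = 1 \<Longrightarrow> x * (y * z) = z" for x y z :: "'a::monoid_mult"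
  by (simp add: mult.assoc [symmetric])

lemma unipotent_inverse:
  fixes n :: "'a::{ring,monoid_mult}"
  assumes "n * n = 0"
  shows "(1 + n) * (1 - n) = 1" "(1 - n) * (1 + n) = 1"
  using assms by (simp_all add: algebra_simps)

text \<open>Each factor is inverted explicitly: the unipotent ones are 1 plus or minus an element of
  square zero, and \<Upsilon> is an exponential.\<close>

lemma R21_R_inverse:
  obtains W where "W * (R21\<^sub>h * R\<^sub>h) = 1" "(R21\<^sub>h * R\<^sub>h) * W = 1"
proof -
  let ?a = "hscalar q_diff * (e1 * f2)" and ?b = "hscalar q_diff * (f1 * e2 * (k1 * ki2))"
  have "e1 * f2 * (e1 * f2) = 0"
    by (simp add: mult.assoc emb_simps U2.f_f)
  hence a: "?a * ?a = 0" by (rule hscalar_square_zero)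
  have "f1 * e2 * (k1 * ki2) * (f1 * e2 * (k1 * ki2)) = 0"
    by (simp add: mult.assoc emb_simps copy_simps k_left_simps) (simp add: U1.f_f U2.e_e flip: mult.assoc)
  hence b: "?b * ?b = 0" by (rule hscalar_square_zero)
  let ?Y = "hexp (- logUpsilon)"
  have Y: "Upsilon * ?Y = 1" "?Y * Upsilon = 1" unfolding Upsilon_eq by (rule hexp_minus)+
  define A A' B B' where AB: "A = 1 - ?a" "A' = 1 + ?a" "B = 1 + ?b" "B' = 1 - ?b"
  have inv: "A * A' = 1" "A' * A = 1" "B * B' = 1" "B' * B = 1"
    unfolding AB by (rule unipotent_inverse[OF a] unipotent_inverse[OF b])+
  note cancel = inv Y inv[THEN left_cancel_inverse] Y[THEN left_cancel_inverse]
  have 1: "A * (B * (Upsilon * Upsilon)) * (?Y * ?Y * (B' * A')) = 1"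
    and 2: "(?Y * ?Y * (B' * A')) * (A * (B * (Upsilon * Upsilon))) = 1"
    by (simp_all only: mult.assoc cancel)
  show ?thesis by (rule that[OF 2[unfolded AB, folded R21_R_eq] 1[unfolded AB, folded R21_R_eq]])
qed

section \<open>The coproduct of v\<close>

lemma comult_gens: "comult E\<^sub>h = e1 * ki2 + e2" "comult F\<^sub>h = f1 + k1 * f2"
  "comult H1\<^sub>h = emb1 H1\<^sub>h + emb2 H1\<^sub>h" "comult H2\<^sub>h = emb1 H2\<^sub>h + emb2 H2\<^sub>h"
  by (simp_all only: comult_generator E\<^sub>h_def F\<^sub>h_def H1\<^sub>h_def H2\<^sub>h_def)
    (simp_all only: comult_gen_eq E\<^sub>h_def F\<^sub>h_def H1\<^sub>h_def H2\<^sub>h_def)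

lemmas comult_hom = hlin_add[OF halg_hom_lin[OF halg_hom_comult]] hlin_diff[OF halg_hom_lin[OF halg_hom_comult]]
  hlin_uminus[OF halg_hom_lin[OF halg_hom_comult]] hlin_hscalar[OF halg_hom_lin[OF halg_hom_comult]]
  halg_hom_mult[OF halg_hom_comult] halg_hom_hscalar[OF halg_hom_comult] halg_hom_hexp[OF halg_hom_comult]

lemma comult_Kinv: "comult Kinv\<^sub>h = ki1 * ki2"
proof -
  have "comult Kinv\<^sub>h = hexp (- hsum1 + - hsum2)"
    by (simp add: Kinv\<^sub>h_def comult_hom comult_gens algebra_simps)
  also have "\<dots> = ki1 * ki2"
    unfolding U1.ki_def U2.ki_def by (rule hexp_add) (simp add: algebra_simps emb_simps)
  finally show ?thesis .
qed

text \<open>Squaring H \<otimes> 1 + 1 \<otimes> H produces the cross term 2 H \<otimes> H; in the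
  difference of squares these add up to -2 \<open>logUpsilon\<close>.\<close>

lemma comult_t: "comult U.t = emb1 U.t * (emb2 U.t * (hexp (- logUpsilon) * hexp (- logUpsilon)))"
proof -
  let ?s1 = "emb1 H2\<^sub>h ^ 2 - emb1 H1\<^sub>h ^ 2 :: UhUh" and ?s2 = "emb2 H2\<^sub>h ^ 2 - emb2 H1\<^sub>h ^ 2 :: UhUh"
  have "comult U.t = hexp (?s1 + (?s2 + (- logUpsilon + - logUpsilon)))"
    unfolding U.t_def power2_eq_square comult_hom comult_gens
    by (rule arg_cong[of _ _ hexp]) (simp add: algebra_simps emb_simps)
  also have "\<dots> = hexp ?s1 * hexp (?s2 + (- logUpsilon + - logUpsilon))"
    by (rule hexp_add) (simp add: power2_eq_square algebra_simps emb_simps copy_simps)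
  also have "hexp (?s2 + (- logUpsilon + - logUpsilon)) = hexp ?s2 * hexp (- logUpsilon + - logUpsilon)"
    by (rule hexp_add) (simp add: power2_eq_square algebra_simps emb_simps copy_simps)
  also have "hexp (- logUpsilon + - logUpsilon) = hexp (- logUpsilon) * hexp (- logUpsilon)"
    by (rule hexp_add) simp
  finally show ?thesis by (simp only: U1.t_def U2.t_def)
qed

text \<open>This form of the coproduct formula contains no inverse. \<Upsilon>^2 moves through the
  first factor of \<Delta>(v) and cancels against \<Delta>(T); then the two unipotent factors of the
  double braiding absorb the mixed terms f1 e2 and e1 f2 in turn.\<close>

lemma R21_R_comult:
  assumes v: "v = (Kinv\<^sub>h + hscalar q_diff * E\<^sub>h * F\<^sub>h) * U.t"
  shows "R21\<^sub>h * R\<^sub>h * comult v = v \<otimes>\<^sub>h v"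
proof -
  define z :: UhUh where "z = hscalar q_diff"
  have z_left: "x * (z * y) = z * (x * y)" "x * z = z * x" for x y
    unfolding z_def by (rule hscalar_left_commute, rule hscalar_commute [symmetric])
  have sq: "e1 * (e1 * x) = 0" "f1 * (f1 * x) = 0" "e2 * (e2 * x) = 0" "f2 * (f2 * x) = 0" for x
    by (simp_all add: U1.e_e U1.f_f U2.e_e U2.f_f flip: mult.assoc)
  have f1_e1: "z * (f1 * (e1 * x)) = k1 * x - ki1 * x - z * (e1 * (f1 * x))" for x
    using arg_cong[OF U1.q_diff_e_f, of "\<lambda>y. y * x"] by (simp add: algebra_simps z_def)
  have "z * (f2 * (e2 * x)) = k2 * x - ki2 * x - z * (e2 * (f2 * x))" for x
    using arg_cong[OF U2.q_diff_e_f, of "\<lambda>y. y * x"] by (simp add: algebra_simps z_def)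
  \<comment> \<open>The normal form puts e1 between z and the second tensor factor, so the rule for
    f2 e2 is prefixed by e1 to match.\<close>
  hence f2_e2: "z * (e1 * (f2 * (e2 * x))) = e1 * (k2 * x - ki2 * x - z * (e2 * (f2 * x)))" for x
    by (metis z_left(1))
  note k_commutes = U1.k_e [symmetric] U1.k_f [symmetric] U2.k_e [symmetric] U2.k_f [symmetric]
    emb1_even_emb2[OF even_K(1), of E\<^sub>h] emb1_even_emb2[OF even_K(1), of F\<^sub>h]
    emb1_even_emb2[OF even_K(2), of E\<^sub>h] emb1_even_emb2[OF even_K(2), of F\<^sub>h]
    emb2_emb1_even[OF even_K(1), of E\<^sub>h, symmetric] emb2_emb1_even[OF even_K(1), of F\<^sub>h, symmetric]
    emb2_emb1_even[OF even_K(2), of E\<^sub>h, symmetric] emb2_emb1_even[OF even_K(2), of F\<^sub>h, symmetric]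
    emb2_emb1_even[OF even_K(1), of K\<^sub>h] emb2_emb1_even[OF even_K(1), of Kinv\<^sub>h]
    emb2_emb1_even[OF even_K(2), of K\<^sub>h] emb2_emb1_even[OF even_K(2), of Kinv\<^sub>h]
  \<comment> \<open>Rewriting to the normal form: powers of the \<open>K\<close>s, then powers of \<open>z\<close>, then \<open>E, F\<close> of the first
    factor, then \<open>E, F\<close> of the second factor.\<close>
  note nf = k_commutes k_commutes[THEN left_commute_of_commute]
    z_left[of e1] z_left[of f1] z_left[of e2] z_left[of f2]
    z_left[of k1, symmetric] z_left[of ki1, symmetric] z_left[of k2, symmetric] z_left[of ki2, symmetric]
    emb_odd_anticommute emb_odd_left_anticommute sq U1.e_e U1.f_f U2.e_e U2.f_f
    U1.k_ki U1.k_ki_assoc U2.k_ki U2.k_ki_assoc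
  \<comment> \<open>\<open>M\<close> is \<Delta>(Kinv + z E F). \<open>M'\<close> is its conjugate
    by \<Upsilon>^2, which changes only the coefficients of e1 f2 and f1 e2. \<open>M''\<close> is
    what remains after the term f1 e2 is removed, and its last summand is removed by the factor 1 -
    z e1 f2.\<close>
  define M where "M = ki1 * ki2 + z * (ki2 * (e1 * f1) + k1 * (ki2 * (e1 * f2)) - f1 * e2 + k1 * (e2 * f2))"
  define M' where "M' = ki1 * ki2 + z * (ki2 * (e1 * f1) + ki1 * (k2 * (e1 * f2)) -
      k1 * (k1 * (ki2 * (ki2 * (f1 * e2)))) + k1 * (e2 * f2))"
  define M'' where "M'' = (ki1 + z * (e1 * f1)) * (ki2 + z * (e2 * f2)) + z * (ki1 * (k2 * (e1 * f2)))"
  have comult_v: "comult v = M * comult U.t"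
    unfolding v comult_hom mult.assoc[of "hscalar _"] comult_Kinv comult_gens
    by (rule arg_cong[of _ _ "\<lambda>x. x * comult U.t"]) (simp add: M_def algebra_simps nf flip: z_def)
  have Upsilon_M: "Upsilon * (Upsilon * M) = M' * (Upsilon * Upsilon)"
  proof -
    have "logUpsilon * k1 = k1 * logUpsilon" "logUpsilon * ki1 = ki1 * logUpsilon" "logUpsilon * k2 = k2 * logUpsilon" "logUpsilon * ki2 = ki2 * logUpsilon"
      "logUpsilon * (e1 * f1) = (e1 * f1) * logUpsilon" "logUpsilon * (e2 * f2) = (e2 * f2) * logUpsilon"
      by (simp_all add: algebra_simps emb_simps copy_simps k_left_simps)
    note c = this[THEN Upsilon_commute]
    note cl = c[THEN left_commute_of_commute, unfolded mult.assoc]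
    have conj: "Upsilon * (f1 * (e2 * x)) = k1 * (ki2 * (f1 * (e2 * (Upsilon * x))))"
      "Upsilon * (e1 * (f2 * x)) = ki1 * (k2 * (e1 * (f2 * (Upsilon * x))))" for x
      using arg_cong[OF Upsilon_conj(1), of "\<lambda>y. y * x"] arg_cong[OF Upsilon_conj(2), of "\<lambda>y. y * x"]
      by (simp_all add: mult.assoc nf)
    show ?thesis
      unfolding M_def M'_def
      by (simp add: algebra_simps c[unfolded mult.assoc] cl conj conj[of 1, simplified] z_left[of Upsilon] nf)
  qed
  have B: "(1 + z * (f1 * e2 * (k1 * ki2))) * M' = M''"
    unfolding M'_def M''_def by (simp add: algebra_simps nf f1_e1 f1_e1[of 1, simplified])
  have A: "(1 - z * (e1 * f2)) * M'' = (ki1 + z * (e1 * f1)) * (ki2 + z * (e2 * f2))"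
    unfolding M''_def by (simp add: algebra_simps nf f2_e2 f2_e2[of 1, simplified])
  have Upsilon_t: "Upsilon * (Upsilon * comult U.t) = emb1 U.t * emb2 U.t"
  proof -
    note ct = U1.t_h [symmetric] U2.t_h [symmetric] emb2_emb1_even[OF even_t] emb1_even_emb2[OF even_t]
    have "logUpsilon * emb1 U.t = emb1 U.t * logUpsilon" "logUpsilon * emb2 U.t = emb2 U.t * logUpsilon"
      by (simp_all add: algebra_simps ct ct[THEN left_commute_of_commute])
    note c = this[THEN Upsilon_commute, THEN left_commute_of_commute]
    have "Upsilon * hexp (- logUpsilon) = 1" unfolding Upsilon_eq by (rule hexp_minus)
    thus ?thesis unfolding comult_t c by (simp only: left_cancel_inverse mult_1_right)
  qed
  have "R21\<^sub>h * R\<^sub>h * comult v =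
      (1 - z * (e1 * f2)) * ((1 + z * (f1 * e2 * (k1 * ki2))) * (Upsilon * (Upsilon * M) * comult U.t))"
    unfolding R21_R_eq comult_v z_def by (simp only: mult.assoc)
  also have "\<dots> = (1 - z * (e1 * f2)) * ((1 + z * (f1 * e2 * (k1 * ki2))) * M') * (Upsilon * (Upsilon * comult U.t))"
    unfolding Upsilon_M by (simp only: mult.assoc)
  also have "\<dots> = (ki1 + z * (e1 * f1)) * (ki2 + z * (e2 * f2)) * (emb1 U.t * emb2 U.t)"
    unfolding B A Upsilon_t ..
  also have "\<dots> = (ki1 + z * (e1 * f1)) * (emb1 U.t * (ki2 + z * (e2 * f2))) * emb2 U.t"
  proof -
    have "(ki2 + z * (e2 * f2)) * emb1 U.t = emb1 U.t * (ki2 + z * (e2 * f2))"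
      using emb1_even_emb2[OF even_t, of "Kinv\<^sub>h + hscalar q_diff * (E\<^sub>h * F\<^sub>h)"]
      by (simp only: hlin_add[OF halg_hom_lin[OF halg_hom_emb2]] halg_hom_hscalar[OF halg_hom_emb2]
          halg_hom_mult[OF halg_hom_emb2] z_def)
    from arg_cong[OF this, of "\<lambda>x. (ki1 + z * (e1 * f1)) * (x * emb2 U.t)"]
    show ?thesis by (simp only: mult.assoc)
  qed
  also have "\<dots> = v \<otimes>\<^sub>h v"
    unfolding v tensor_eq mult.assoc[of "hscalar _"]
    by (simp only: halg_hom_mult[OF halg_hom_emb1] halg_hom_mult[OF halg_hom_emb2] z_def
        hlin_add[OF halg_hom_lin[OF halg_hom_emb1]] halg_hom_hscalar[OF halg_hom_emb1]
        hlin_add[OF halg_hom_lin[OF halg_hom_emb2]] halg_hom_hscalar[OF halg_hom_emb2] mult.assoc)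
  finally show ?thesis .
qed

theorem proposition2p5:
  fixes v :: Uh
  assumes "v = Kinv\<^sub>h * u\<^sub>h"
  shows "v = u\<^sub>h * Kinv\<^sub>h \<and>
         v = (Kinv\<^sub>h + hscalar q_diff * E\<^sub>h * F\<^sub>h) * hexp (H2\<^sub>h ^ 2 - H1\<^sub>h ^ 2) \<and>
         even_elem v \<and>
         (\<forall>x. v * x = x * v) \<and>
         v ^ 2 = u\<^sub>h * antipode u\<^sub>h \<and>
         counit v = 1 \<and>
         antipode v = v \<and>
         (\<exists>W. W * (R21\<^sub>h * R\<^sub>h) = 1 \<and> (R21\<^sub>h * R\<^sub>h) * W = 1 \<and> comult v = W * (v \<otimes>\<^sub>h v))"
proof -
  have v: "v = (Kinv\<^sub>h + hscalar q_diff * E\<^sub>h * F\<^sub>h) * U.t"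
    unfolding assms u_eq
    by (simp add: algebra_simps hscalar_left_commute[of "Kinv\<^sub>h"] U.k_e(2)[THEN left_commute_of_commute]
        U.k_ki_assoc)
  note central = v_central[OF v]
  have u: "u\<^sub>h = v * K\<^sub>h"
    using central[of "K\<^sub>h"] by (simp add: assms U.k_ki_assoc)
  have "v = u\<^sub>h * Kinv\<^sub>h" by (simp add: u mult.assoc U.k_ki)
  moreover have "even_elem v"
  proof -
    have EF: "even_elem (E\<^sub>h * F\<^sub>h)"
      by (simp add: E\<^sub>h_def F\<^sub>h_def hbasis_word_append [symmetric] even_elem_hbasis bpar_word_def)
    show ?thesis
      unfolding v mult.assoc[of "hscalar _"]
      by (rule even_elem_mult[OF even_elem_add[OF even_K(2) even_elem_mult[OF even_elem_hscalar EF]] even_t])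
  qed
  moreover have S: "antipode v = v"
  proof -
    have "antipode v = U.t * (K\<^sub>h - hscalar q_diff * (F\<^sub>h * E\<^sub>h))"
      using antipode_mult_K(2)[of 1]
      by (simp add: v antipode_mult_t antipode_lin hlin_hscalar[OF hlin_antipode] mult.assoc antipode_1 antipode_E_F)
    \<comment> \<open>The relation z (EF + FE) = K - Kinv undoes both effects of S, the exchange of
      K with its inverse and S(EF) = -FE.\<close>
    also have "K\<^sub>h - hscalar q_diff * (F\<^sub>h * E\<^sub>h) = Kinv\<^sub>h + hscalar q_diff * E\<^sub>h * F\<^sub>h"
      using U.q_diff_e_f by (simp add: algebra_simps)
    \<comment> \<open>EF has weight zero, so the shifts of \<open>U.t\<close> past E and F
      cancel.\<close>
    also have "U.t * \<dots> = v"
      unfolding v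
      by (simp add: algebra_simps hscalar_left_commute[of U.t] U.k_t)
        (simp add: mult.assoc [symmetric] U.t_e, simp add: mult.assoc U.t_f U.k_f U.k_f[THEN left_commute_of_commute] U.k_ki_assoc)
    finally show ?thesis .
  qed
  \<comment> \<open>As S(v K) = Kinv S(v), the factors K and Kinv meet and u S(u) reduces to v
    S(v).\<close>
  moreover have "v ^ 2 = u\<^sub>h * antipode u\<^sub>h"
    unfolding u antipode_mult_K S by (simp add: power2_eq_square mult.assoc U.k_ki_assoc)
  moreover have "counit v = 1"
  proof -
    have 0: "counit H1\<^sub>h = 0" "counit H2\<^sub>h = 0" "counit E\<^sub>h = 0"
      by (simp_all add: H1\<^sub>h_def H2\<^sub>h_def E\<^sub>h_def counit_generator)
    have "counit Kinv\<^sub>h = 1" unfolding Kinv\<^sub>h_def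
      by (rule counit_hexp) (simp only: counit_uminus counit_add 0, simp)
    moreover have "counit U.t = 1" unfolding U.t_def diff_conv_add_uminus
      by (rule counit_hexp) (simp only: counit_uminus counit_add counit_power 0, simp)
    ultimately show ?thesis by (simp add: v counit_mult counit_add 0)
  qed
  moreover have "\<exists>W. W * (R21\<^sub>h * R\<^sub>h) = 1 \<and> (R21\<^sub>h * R\<^sub>h) * W = 1 \<and> comult v = W * (v \<otimes>\<^sub>h v)"
  proof -
    obtain W where W: "W * (R21\<^sub>h * R\<^sub>h) = 1" "(R21\<^sub>h * R\<^sub>h) * W = 1" by (rule R21_R_inverse)
    moreover have "comult v = W * (v \<otimes>\<^sub>h v)"
      unfolding R21_R_comult[OF v, symmetric] mult.assoc[of _ _ "comult v", symmetric] W(1) by simp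
    ultimately show ?thesis by blast
  qed
  ultimately show ?thesis using v central by (simp only: U.t_def simp_thms)
qed

end
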